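(* Let $g:[0,1]\to[0,\infty)$ be piecewise $C^2$ on $[0,1]$, and suppose that for some $\epsilon>0$ we have $g(x)\ge\epsilon$ on $[1-\epsilon,1]$. Let $T$ be the nonnegative random variable whose distribution is determined by $$C(\theta):=\log \mathbb{E}\, e^{\theta T}=\int_0^1 (e^{\theta x}-1)\,g(x)\,dx ,\qquad \theta\in\mathbb{R},$$ and let $f$ be the defective density function of $T$. Given $u>0$, let $\beta=\beta(u)$ be such that $C'(\beta)=u$, and let $\sigma_\beta^2=C''(\beta)$ with $\sigma_\beta>0$. Then as $u\to\infty$, $$f(u)=\frac{e^{C(\beta)-u\beta}}{\sqrt{2\pi}\,\sigma_\beta}\left(1+O\left(\frac1u\right)\right)$$ and $$\mathbb{P}(T\ge u)=\frac1\beta\,\frac{e^{C(\beta)-u\beta}}{\sqrt{2\pi}\,\sigma_\beta}\left(1+O\left(\frac{1}{\sqrt u}\right)\right),$$ and hence $\mathbb{P}(T\ge u)=\dfrac{f(u)}{\beta}\left(1+O\left(\dfrac1{\sqrt u}\right)\right)$.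
   Context: A function $g$ is piecewise $C^k$ on $[a,1]$ (integer $k\ge1$) if $[a,1]$ can be partitioned into finitely many subintervals on whose interiors $g$ is $C^k$, and $g$ and its first $k$ derivatives all possess finite one-sided limits at all the endpoints of the subintervals (so $g$ is bounded). $T$ has the infinitely divisible distribution with Lévy measure $g(x)\,dx$, i.e. $T$ is the sum of all arrivals in a Poisson process on $(0,1]$ with intensity $g(x)\,dx$. Since $\lambda=\int_0^1 g(x)\,dx<\infty$, $T$ has an atom at $0$ with $\mathbb{P}(T=0)=e^{-\lambda}$; the rest of the distribution of $T$ is absolutely continuous with a "defective" density $f$ on $(0,\infty)$, $\int f=1-e^{-\lambda}$. The version of $f$ used is the one that is continuous on $(1,\infty)$. The implied constants in $O(\cdot)$ may depend on $g$. *)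

theory Defs
  imports "HOL-Probability.Probability" "HOL-Library.Landau_Symbols"
begin

text \<open>On each open piece only the values of \<open>g\<close> in that piece enter the iterated derivatives; the
  values of \<open>g\<close> at the partition points are unconstrained.\<close>

definition piecewise_C :: "nat \<Rightarrow> real \<Rightarrow> real \<Rightarrow> (real \<Rightarrow> real) \<Rightarrow> bool" where
  "piecewise_C k a b g \<longleftrightarrow>
     (\<exists>(n::nat) t. t 0 = a \<and> t n = b \<and>
        (\<forall>i<n. t i < t (Suc i) \<and>
           (\<forall>j<k. \<forall>x\<in>{t i<..<t (Suc i)}. (deriv ^^ j) g differentiable (at x)) \<and>
           continuous_on {t i<..<t (Suc i)} ((deriv ^^ k) g) \<and>
           (\<forall>j\<le>k. (\<exists>l. ((deriv ^^ j) g \<longlongrightarrow> l) (at_right (t i))) \<and>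
                  (\<exists>l. ((deriv ^^ j) g \<longlongrightarrow> l) (at_left (t (Suc i)))))))"

definition levy_cgf :: "(real \<Rightarrow> real) \<Rightarrow> real \<Rightarrow> real" where
  "levy_cgf g \<theta> = (LBINT x:{0..1}. (exp (\<theta> * x) - 1) * g x)"

text \<open>The Bochner integral of a non-integrable function is \<open>0\<close> and \<open>ln 0 = 0\<close>, so finiteness of
  the exponential moments has to be stated explicitly.\<close>

definition has_levy_density :: "'a measure \<Rightarrow> ('a \<Rightarrow> real) \<Rightarrow> (real \<Rightarrow> real) \<Rightarrow> bool" where
  "has_levy_density M T g \<longleftrightarrow>
     T \<in> borel_measurable M \<and> (AE \<omega> in M. 0 \<le> T \<omega>) \<and>
     (\<forall>\<theta>. integrable M (\<lambda>\<omega>. exp (\<theta> * T \<omega>)) \<and>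
          ln (\<integral>\<omega>. exp (\<theta> * T \<omega>) \<partial>M) = levy_cgf g \<theta>)"

text \<open>The density of the part of the law of \<open>T\<close> that lives on \<open>{0<..}\<close>; its total mass is less than
  one because of the atom of \<open>T\<close> at \<open>0\<close>.\<close>

definition defective_density :: "'a measure \<Rightarrow> ('a \<Rightarrow> real) \<Rightarrow> (real \<Rightarrow> real) \<Rightarrow> bool" where
  "defective_density M T f \<longleftrightarrow>
     set_borel_measurable borel {0<..} f \<and> (\<forall>x>0. 0 \<le> f x) \<and>
     (\<forall>A\<in>sets borel. A \<subseteq> {0<..} \<longrightarrow>
        emeasure (distr M borel T) A = (\<integral>\<^sup>+x\<in>A. ennreal (f x) \<partial>lborel))"

definition saddlepoint :: "(real \<Rightarrow> real) \<Rightarrow> real \<Rightarrow> real \<Rightarrow> real" where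
  "saddlepoint g \<beta> u =
     exp (levy_cgf g \<beta> - u * \<beta>) / (sqrt (2 * pi) * sqrt (deriv (deriv (levy_cgf g)) \<beta>))"

end

theory Submission
  imports Defs "HOL-Complex_Analysis.Conformal_Mappings" "HOL-Real_Asymp.Real_Asymp"
begin

text \<open>
  Extend \<open>g\<close> by zero to a function \<open>w\<close> and put \<open>H z = \<integral> w x * exp (z * x) dx\<close>. By hypothesis
  \<open>E (exp (z * T)) = exp (H z - H 0)\<close> for real \<open>z\<close>; both sides are entire, so the identity holds for
  every complex \<open>z\<close> (\<open>complex_mgf_eq\<close>). Hence the density of \<open>T\<close> at \<open>u\<close> ought to be the Fourier
  integral of \<open>exp (H z - H 0 - u * z) / (2 * pi)\<close> along any vertical line \<open>Re z = b\<close>, and the choice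
  \<open>b = \<beta> u\<close>, for which the exponent has a critical point at \<open>b\<close>, removes the oscillation of the
  integrand near \<open>z = b\<close>, where its modulus is largest.

  That integral does not converge: on the line, \<open>exp (H z)\<close> tends to \<open>1\<close>, which reflects the atom of \<open>T\<close> at
  \<open>0\<close>, and the next term \<open>H z\<close> of the exponential series is the transform of \<open>w\<close>, which may jump.
  But the atom and \<open>w\<close> live on \<open>{0..1}\<close>, so for points beyond \<open>1\<close> both terms can be
  subtracted. What is left, \<open>exp (H z) - 1 - H z\<close>, is of size \<open>(norm (H z))\<^sup>2\<close>, and \<open>H\<close> is square
  integrable on the line by a Plancherel estimate (\<open>fourier_sq_bound\<close>). This gives the exact formula
  \<open>density_inversion\<close>, proved by smoothing with a narrow Gaussian and letting its width tend to \<open>0\<close>.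

  The integral is then estimated in two regions. Write \<open>\<kappa> k\<close> for the \<open>k\<close>-th derivative of \<open>H\<close> at
  \<open>b\<close>, so that \<open>\<kappa> 1 = u\<close>. Since \<open>w\<close> is supported in \<open>{0..1}\<close>, all higher \<open>\<kappa> k\<close> are at most
  \<open>u\<close>; since \<open>w\<close> is bounded below near \<open>1\<close>, where most of the tilted mass sits, \<open>\<kappa> 2 \<ge> u / 4\<close> for
  large \<open>b\<close>. For \<open>\<bar>t\<bar> \<le> 1/4\<close> a Taylor expansion replaces the integrand by
  \<open>exp (- \<kappa> 2 * t\<^sup>2 / 2) * (1 - \<i> * \<kappa> 3 * t ^ 3 / 6)\<close> (\<open>centred_local\<close>). For \<open>\<bar>t\<bar> \<ge> 1/4\<close> one has
  \<open>norm (H (b + \<i> * t)) \<le> H b - \<rho>\<close> with \<open>\<rho>\<close> growing faster than \<open>b\<^sup>2\<close>, while \<open>u\<close> is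
  only \<open>O (exp b)\<close>, so that region contributes less than any power of \<open>u\<close>
  (\<open>norm_transform_le_rho\<close>, \<open>rho_large\<close>). The total error is \<open>O (1 / (u * sqrt u))\<close>, against a main term
  of order \<open>1 / sqrt u\<close> (\<open>err_integral\<close>). At \<open>x = u\<close> the cubic term is odd and integrates to zero,
  whence the relative error \<open>O (1 / u)\<close> for the density (\<open>density_saddle\<close>).

  For the tail, the density at \<open>u + y\<close> is read off from the same line \<open>Re z = \<beta> u\<close>. Moving
  the point by \<open>y\<close> costs an error \<open>O ((1 + y) / u)\<close> in the integral (\<open>centred_integral_shifted\<close>), and
  the factor \<open>exp (- b * y)\<close> that comes with it integrates to \<open>1 / b\<close>; this yields the tail with relative
  error \<open>O (1 / sqrt u)\<close> (\<open>tail_saddle\<close>). The last claim is the quotient of the first two.\<close>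

section \<open>Exponential transforms of weighted measures\<close>

text \<open>The weight \<open>w\<close> makes one notion serve both transforms of the proof: that of the law of \<open>T\<close>
  (weight \<open>1\<close>) and that of the intensity (Lebesgue measure weighted by the intensity).\<close>

definition cmgf :: "'a measure \<Rightarrow> ('a \<Rightarrow> real) \<Rightarrow> ('a \<Rightarrow> real) \<Rightarrow> complex \<Rightarrow> complex" where
  "cmgf N w X z = (\<integral>\<omega>. complex_of_real (w \<omega>) * exp (z * complex_of_real (X \<omega>)) \<partial>N)"

lemma norm_integral_le:
  fixes f :: "'a \<Rightarrow> 'b :: {banach, second_countable_topology}"
  assumes g: "integrable N g" and le: "\<And>x. norm (f x) \<le> g x"
  shows "norm (integral\<^sup>L N f) \<le> integral\<^sup>L N g"
proof -
  have "norm (integral\<^sup>L N f) \<le> (\<integral>x. norm (f x) \<partial>N)"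
    by (rule integral_norm_bound)
  also have "\<dots> \<le> integral\<^sup>L N g"
    by (rule integral_mono_AE') (use g le in \<open>auto intro!: AE_I2 intro: order_trans[OF norm_ge_zero]\<close>)
  finally show ?thesis .
qed

lemma integral_diff_le_of_pointwise:
  fixes F main bound :: "'b \<Rightarrow> real"
  assumes "F \<in> borel_measurable N" and main: "integrable N main" and bound: "integrable N bound"
    and le: "\<And>x. \<bar>F x - main x\<bar> \<le> bound x"
  shows "\<bar>integral\<^sup>L N F - integral\<^sup>L N main\<bar> \<le> integral\<^sup>L N bound"
proof -
  have [measurable]: "F \<in> borel_measurable N" "main \<in> borel_measurable N"
    using assms by auto
  have "integrable N (\<lambda>x. F x - main x)"
    by (rule Bochner_Integration.integrable_bound[OF bound])
       (use le in \<open>auto intro!: AE_I2 order_trans[OF le abs_ge_self]\<close>)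
  then have "integrable N (\<lambda>x. (F x - main x) + main x)"
    by (rule Bochner_Integration.integrable_add[OF _ main])
  then have "integral\<^sup>L N F - integral\<^sup>L N main = (\<integral>x. F x - main x \<partial>N)"
    using main by simp
  then show ?thesis
    using norm_integral_le[OF bound, of "\<lambda>x. F x - main x"] le by simp
qed

lemma norm_exp_remainder: "norm (exp z - 1 - z) \<le> exp \<bar>Re z\<bar> * (norm z)\<^sup>2"
  using Taylor_exp[of z 1] by (simp add: power2_eq_square algebra_simps)

text \<open>Finiteness of all real exponential moments absorbs any polynomial factor, because
  \<open>1 + \<bar>y\<bar> + y\<^sup>2 \<le> 2 * exp \<bar>y\<bar>\<close> and \<open>exp \<bar>y\<bar> \<le> exp y + exp (- y)\<close>. This is the domination used for
  differentiating under the integral sign.\<close>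

lemma integrable_moment_exp:
  fixes w X :: "'a \<Rightarrow> real"
  assumes [measurable]: "w \<in> borel_measurable N" "X \<in> borel_measurable N"
    and exp_int: "\<And>\<theta>. integrable N (\<lambda>\<omega>. w \<omega> * exp (\<theta> * X \<omega>))"
  shows "integrable N (\<lambda>\<omega>. \<bar>w \<omega>\<bar> * (1 + \<bar>X \<omega>\<bar> + (X \<omega>)\<^sup>2) * exp (a * \<bar>X \<omega>\<bar>))"
proof -
  let ?b = "\<bar>a\<bar> + 1"
  have "integrable N (\<lambda>\<omega>. 2 * (\<bar>w \<omega> * exp (?b * X \<omega>)\<bar> + \<bar>w \<omega> * exp (- (?b * X \<omega>))\<bar>))"
    using exp_int[of ?b] exp_int[of "- ?b"] unfolding minus_mult_left
    by (intro integrable_mult_right Bochner_Integration.integrable_add integrable_abs)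
  then show ?thesis
  proof (rule Bochner_Integration.integrable_bound)
    show "AE \<omega> in N. norm (\<bar>w \<omega>\<bar> * (1 + \<bar>X \<omega>\<bar> + (X \<omega>)\<^sup>2) * exp (a * \<bar>X \<omega>\<bar>))
        \<le> norm (2 * (\<bar>w \<omega> * exp (?b * X \<omega>)\<bar> + \<bar>w \<omega> * exp (- (?b * X \<omega>))\<bar>))"
    proof (rule AE_I2)
      fix \<omega>
      let ?y = "\<bar>X \<omega>\<bar>"
      have "1 + ?y + ?y\<^sup>2 / 2 \<le> exp ?y"
        by (rule exp_lower_Taylor_quadratic) simp
      then have poly: "1 + ?y + (X \<omega>)\<^sup>2 \<le> 2 * exp ?y"
        by (simp add: add_increasing)
      have "exp (a * ?y) \<le> exp (\<bar>a\<bar> * ?y)"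
        by (simp add: mult_right_mono)
      then have "(1 + ?y + (X \<omega>)\<^sup>2) * exp (a * ?y) \<le> 2 * exp ?y * exp (\<bar>a\<bar> * ?y)"
        by (intro mult_mono poly) auto
      also have "\<dots> = 2 * exp (?b * ?y)"
        by (simp add: exp_add[symmetric] algebra_simps)
      also have "\<dots> \<le> 2 * (exp (?b * X \<omega>) + exp (- (?b * X \<omega>)))"
        by (cases "X \<omega> \<ge> 0") auto
      finally have "\<bar>w \<omega>\<bar> * ((1 + ?y + (X \<omega>)\<^sup>2) * exp (a * ?y))
          \<le> \<bar>w \<omega>\<bar> * (2 * (exp (?b * X \<omega>) + exp (- (?b * X \<omega>))))"
        by (intro mult_left_mono) auto
      moreover have "0 \<le> \<bar>w \<omega>\<bar> * ((1 + ?y + (X \<omega>)\<^sup>2) * exp (a * ?y))"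
        by simp
      ultimately show "norm (\<bar>w \<omega>\<bar> * (1 + \<bar>X \<omega>\<bar> + (X \<omega>)\<^sup>2) * exp (a * \<bar>X \<omega>\<bar>))
        \<le> norm (2 * (\<bar>w \<omega> * exp (?b * X \<omega>)\<bar> + \<bar>w \<omega> * exp (- (?b * X \<omega>))\<bar>))"
        by (simp add: abs_mult algebra_simps)
    qed
  qed simp
qed

lemma integrable_weighted_moment_exp:
  fixes w X :: "'a \<Rightarrow> real"
  assumes [measurable]: "w \<in> borel_measurable N" "X \<in> borel_measurable N"
    and exp_int: "\<And>\<theta>. integrable N (\<lambda>\<omega>. w \<omega> * exp (\<theta> * X \<omega>))"
  shows "integrable N (\<lambda>\<omega>. (w \<omega> * X \<omega>) * exp (\<theta> * X \<omega>))"
proof (rule Bochner_Integration.integrable_bound[OF integrable_moment_exp[OF assms, of "\<bar>\<theta>\<bar>"]])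
  show "AE \<omega> in N. norm (w \<omega> * X \<omega> * exp (\<theta> * X \<omega>))
      \<le> norm (\<bar>w \<omega>\<bar> * (1 + \<bar>X \<omega>\<bar> + (X \<omega>)\<^sup>2) * exp (\<bar>\<theta>\<bar> * \<bar>X \<omega>\<bar>))"
  proof (rule AE_I2)
    fix \<omega>
    have "\<theta> * X \<omega> \<le> \<bar>\<theta>\<bar> * \<bar>X \<omega>\<bar>"
      by (metis abs_ge_self abs_mult)
    then have "\<bar>X \<omega>\<bar> * exp (\<theta> * X \<omega>) \<le> (1 + \<bar>X \<omega>\<bar> + (X \<omega>)\<^sup>2) * exp (\<bar>\<theta>\<bar> * \<bar>X \<omega>\<bar>)"
      by (intro mult_mono) auto
    then have "\<bar>w \<omega>\<bar> * (\<bar>X \<omega>\<bar> * exp (\<theta> * X \<omega>))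
       \<le> \<bar>w \<omega>\<bar> * ((1 + \<bar>X \<omega>\<bar> + (X \<omega>)\<^sup>2) * exp (\<bar>\<theta>\<bar> * \<bar>X \<omega>\<bar>))"
      by (rule mult_left_mono) simp
    then show "norm (w \<omega> * X \<omega> * exp (\<theta> * X \<omega>))
      \<le> norm (\<bar>w \<omega>\<bar> * (1 + \<bar>X \<omega>\<bar> + (X \<omega>)\<^sup>2) * exp (\<bar>\<theta>\<bar> * \<bar>X \<omega>\<bar>))"
      by (simp add: abs_mult mult.assoc)
  qed
qed simp

lemma integrable_cmgf:
  fixes w X :: "'a \<Rightarrow> real"
  assumes [measurable]: "w \<in> borel_measurable N" "X \<in> borel_measurable N"
    and exp_int: "\<And>\<theta>. integrable N (\<lambda>\<omega>. w \<omega> * exp (\<theta> * X \<omega>))"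
  shows "integrable N (\<lambda>\<omega>. complex_of_real (w \<omega>) * exp (z * complex_of_real (X \<omega>)))"
  by (rule Bochner_Integration.integrable_bound[OF exp_int[of "Re z"]])
     (auto simp: norm_mult)

text \<open>The second-order remainder of \<open>exp (h * X)\<close> is at most \<open>(norm h)\<^sup>2\<close> times an integrable function, so the
  difference quotient converges at rate \<open>norm h\<close>.\<close>

lemma cmgf_has_field_derivative:
  fixes w X :: "'a \<Rightarrow> real"
  assumes [measurable]: "w \<in> borel_measurable N" "X \<in> borel_measurable N"
    and exp_int: "\<And>\<theta>. integrable N (\<lambda>\<omega>. w \<omega> * exp (\<theta> * X \<omega>))"
  shows "(cmgf N w X has_field_derivative cmgf N (\<lambda>\<omega>. w \<omega> * X \<omega>) X z) (at z)"
proof -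
  let ?D = "\<lambda>\<omega>. \<bar>w \<omega>\<bar> * (1 + \<bar>X \<omega>\<bar> + (X \<omega>)\<^sup>2) * exp ((norm z + 1) * \<bar>X \<omega>\<bar>)"
  let ?e = "\<lambda>z \<omega>. complex_of_real (w \<omega>) * exp (z * complex_of_real (X \<omega>))"
  let ?e1 = "\<lambda>z \<omega>. complex_of_real (w \<omega> * X \<omega>) * exp (z * complex_of_real (X \<omega>))"
  have D_int: "integrable N ?D"
    by (rule integrable_moment_exp[OF assms])
  have e_int: "integrable N (?e z)" for z
    by (rule integrable_cmgf[OF assms])
  have e1_int: "integrable N (?e1 z)" for z
    by (rule integrable_cmgf)
       (use integrable_weighted_moment_exp[OF assms] in auto)
  have pointwise: "norm (?e (z + h) \<omega> - ?e z \<omega> - h * ?e1 z \<omega>) \<le> (norm h)\<^sup>2 * ?D \<omega>"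
    if h: "norm h \<le> 1" for h \<omega>
  proof -
    let ?X = "complex_of_real (X \<omega>)"
    have "?e (z + h) \<omega> - ?e z \<omega> - h * ?e1 z \<omega>
        = complex_of_real (w \<omega>) * (exp (z * ?X) * (exp (h * ?X) - 1 - h * ?X))"
      by (simp add: algebra_simps exp_add)
    then have "norm (?e (z + h) \<omega> - ?e z \<omega> - h * ?e1 z \<omega>)
        = \<bar>w \<omega>\<bar> * (norm (exp (z * ?X)) * norm (exp (h * ?X) - 1 - h * ?X))"
      by (simp add: norm_mult del: norm_exp_eq_Re)
    also have "\<dots> \<le> \<bar>w \<omega>\<bar> * (exp (norm z * \<bar>X \<omega>\<bar>) * (exp \<bar>X \<omega>\<bar> * ((norm h)\<^sup>2 * (1 + \<bar>X \<omega>\<bar> + (X \<omega>)\<^sup>2))))"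
    proof (intro mult_left_mono mult_mono)
      show "norm (exp (z * ?X)) \<le> exp (norm z * \<bar>X \<omega>\<bar>)"
        by (metis norm_exp norm_mult norm_of_real)
      have "\<bar>Re (h * ?X)\<bar> \<le> norm (h * ?X)"
        by (rule abs_Re_le_cmod)
      also have "\<dots> \<le> \<bar>X \<omega>\<bar>"
        using h by (simp add: norm_mult mult_left_le_one_le)
      finally have "exp \<bar>Re (h * ?X)\<bar> * (norm (h * ?X))\<^sup>2
         \<le> exp \<bar>X \<omega>\<bar> * ((norm h)\<^sup>2 * (1 + \<bar>X \<omega>\<bar> + (X \<omega>)\<^sup>2))"
        by (intro mult_mono) (auto simp: norm_mult power_mult_distrib intro!: mult_left_mono)
      with norm_exp_remainder[of "h * ?X"]
      show "norm (exp (h * ?X) - 1 - h * ?X) \<le> exp \<bar>X \<omega>\<bar> * ((norm h)\<^sup>2 * (1 + \<bar>X \<omega>\<bar> + (X \<omega>)\<^sup>2))"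
        by linarith
    qed auto
    also have "\<dots> = (norm h)\<^sup>2 * ?D \<omega>"
      by (simp add: algebra_simps exp_add)
    finally show ?thesis .
  qed
  let ?F = "cmgf N w X" and ?F' = "cmgf N (\<lambda>\<omega>. w \<omega> * X \<omega>) X z"
  have quot: "norm ((?F (z + h) - ?F z) / h - ?F') \<le> norm h * integral\<^sup>L N ?D"
    if h: "norm h \<le> 1" "h \<noteq> 0" for h
  proof -
    have "?F (z + h) - ?F z - h * ?F' = (\<integral>\<omega>. ?e (z + h) \<omega> - ?e z \<omega> - h * ?e1 z \<omega> \<partial>N)"
      unfolding cmgf_def using e_int e1_int
      by (simp add: Bochner_Integration.integral_diff del: of_real_mult)
    also have "norm \<dots> \<le> (\<integral>\<omega>. (norm h)\<^sup>2 * ?D \<omega> \<partial>N)"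
      by (rule norm_integral_le) (use D_int pointwise[OF h(1)] in auto)
    finally have "norm (?F (z + h) - ?F z - h * ?F') \<le> (norm h)\<^sup>2 * integral\<^sup>L N ?D"
      by simp
    moreover have "(?F (z + h) - ?F z) / h - ?F' = (?F (z + h) - ?F z - h * ?F') / h"
      using h by (simp add: field_simps)
    ultimately show ?thesis
      using h by (simp add: norm_divide power2_eq_square field_simps)
  qed
  have "((\<lambda>h. (?F (z + h) - ?F z) / h - ?F') \<longlongrightarrow> 0) (at 0)"
  proof (rule Lim_null_comparison)
    show "\<forall>\<^sub>F h in at 0. norm ((?F (z + h) - ?F z) / h - ?F') \<le> norm h * integral\<^sup>L N ?D"
      unfolding eventually_at by (rule exI[of _ 1]) (use quot in auto)
    show "((\<lambda>h. norm h * integral\<^sup>L N ?D) \<longlongrightarrow> 0) (at (0::complex))"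
      by (rule tendsto_eq_intros refl | simp)+
  qed
  then show ?thesis
    unfolding DERIV_def by (simp add: LIM_zero_iff)
qed

lemma mgf_has_real_derivative:
  fixes w X :: "'a \<Rightarrow> real"
  assumes [measurable]: "w \<in> borel_measurable N" "X \<in> borel_measurable N"
    and exp_int: "\<And>\<theta>. integrable N (\<lambda>\<omega>. w \<omega> * exp (\<theta> * X \<omega>))"
  shows "((\<lambda>\<theta>. \<integral>\<omega>. w \<omega> * exp (\<theta> * X \<omega>) \<partial>N) has_real_derivative
     (\<integral>\<omega>. (w \<omega> * X \<omega>) * exp (\<theta> * X \<omega>) \<partial>N)) (at \<theta>)"
proof -
  have eq: "cmgf N v X (complex_of_real \<theta>) = complex_of_real (\<integral>\<omega>. v \<omega> * exp (\<theta> * X \<omega>) \<partial>N)" for v \<theta>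
    unfolding cmgf_def integral_complex_of_real[symmetric]
    by (intro Bochner_Integration.integral_cong) (auto simp flip: exp_of_real)
  have "((\<lambda>\<theta>. cmgf N w X (complex_of_real \<theta>)) has_vector_derivative
      cmgf N (\<lambda>\<omega>. w \<omega> * X \<omega>) X (complex_of_real \<theta>)) (at \<theta>)"
    by (rule has_vector_derivative_real_field[OF cmgf_has_field_derivative[OF assms]])
  then have "((\<lambda>\<theta>. Re (cmgf N w X (complex_of_real \<theta>))) has_vector_derivative
      Re (cmgf N (\<lambda>\<omega>. w \<omega> * X \<omega>) X (complex_of_real \<theta>))) (at \<theta>)"
    by (rule bounded_linear.has_vector_derivative[OF bounded_linear_Re])
  then show ?thesis
    by (simp add: eq has_real_derivative_iff_has_vector_derivative)
qed

section \<open>Gaussian smoothing\<close>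

lemma gaussian_fourier:
  fixes s a :: real
  assumes s: "0 < s"
  shows "(\<integral>t. exp (\<i> * complex_of_real (t * a)) * complex_of_real (exp (- t\<^sup>2 / (2 * s\<^sup>2))) \<partial>lborel)
     = complex_of_real (sqrt (2 * pi) * s * exp (- s\<^sup>2 * a\<^sup>2 / 2))"
proof -
  have "complex_of_real (exp (- ((s * a)^2) / 2)) = char std_normal_distribution (s * a)"
    by (simp add: char_std_normal_distribution)
  also have "\<dots> = (\<integral>t. std_normal_density t *\<^sub>R iexp (s * a * t) \<partial>lborel)"
    unfolding char_def by (subst integral_density) auto
  also have "\<dots> = (\<integral>t. complex_of_real (1 / sqrt (2 * pi)) * (exp (\<i> * complex_of_real (s * t * a)) * complex_of_real (exp (- t\<^sup>2 / 2))) \<partial>lborel)"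
    by (intro Bochner_Integration.integral_cong)
       (auto simp: std_normal_density_def scaleR_conv_of_real ac_simps)
  also have "\<dots> = complex_of_real (1 / sqrt (2 * pi)) * (\<integral>t. exp (\<i> * complex_of_real (s * t * a)) * complex_of_real (exp (- t\<^sup>2 / 2)) \<partial>lborel)"
    by (rule integral_mult_right_zero)
  finally have std: "(\<integral>t. exp (\<i> * complex_of_real (s * t * a)) * complex_of_real (exp (- t\<^sup>2 / 2)) \<partial>lborel)
      = complex_of_real (sqrt (2 * pi) * exp (- s\<^sup>2 * a\<^sup>2 / 2))"
    by (simp add: power_mult_distrib field_simps)
  have "(\<integral>t. exp (\<i> * complex_of_real (t * a)) * complex_of_real (exp (- t\<^sup>2 / (2 * s\<^sup>2))) \<partial>lborel)
     = s *\<^sub>R (\<integral>t. exp (\<i> * complex_of_real (s * t * a)) * complex_of_real (exp (- t\<^sup>2 / 2)) \<partial>lborel)"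
    using s by (subst lborel_integral_real_affine[where c = s and t = 0]) (auto simp: power_mult_distrib)
  then show ?thesis
    unfolding std by (simp add: scaleR_conv_of_real)
qed

lemma gaussian_integrable:
  fixes s :: real
  assumes s: "0 < s"
  shows "integrable lborel (\<lambda>t. exp (- t\<^sup>2 / (2 * s\<^sup>2)))"
    and "(\<integral>t. exp (- t\<^sup>2 / (2 * s\<^sup>2)) \<partial>lborel) = sqrt (2 * pi) * s"
proof -
  have eq: "exp (- t\<^sup>2 / (2 * s\<^sup>2)) = sqrt (2 * pi) * s * normal_density 0 s t" for t
    using s by (simp add: normal_density_def real_sqrt_mult)
  show "integrable lborel (\<lambda>t. exp (- t\<^sup>2 / (2 * s\<^sup>2)))"
    unfolding eq using s by simp
  show "(\<integral>t. exp (- t\<^sup>2 / (2 * s\<^sup>2)) \<partial>lborel) = sqrt (2 * pi) * s"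
    unfolding eq using s by simp
qed

text \<open>By Fubini, damping a Fourier transform by a Gaussian of width \<open>s\<close> and inverting it is the same as
  smoothing the measure with a Gaussian of width \<open>1 / s\<close>. The damping makes everything
  absolutely integrable, however slowly the transform decays.\<close>

lemma gaussian_smoothing:
  fixes w X :: "'a \<Rightarrow> real"
  assumes N: "sigma_finite_measure N"
    and s: "0 < s" and w_int: "integrable N w" and [measurable]: "X \<in> borel_measurable N"
  shows "(\<integral>t. (\<integral>\<omega>. complex_of_real (w \<omega>) * exp (\<i> * complex_of_real (t * X \<omega>)) \<partial>N) *
            exp (- (\<i> * complex_of_real (t * x))) * complex_of_real (exp (- t\<^sup>2 / (2 * s\<^sup>2))) \<partial>lborel)
     = complex_of_real (sqrt (2 * pi) * s * (\<integral>\<omega>. w \<omega> * exp (- s\<^sup>2 * (x - X \<omega>)\<^sup>2 / 2) \<partial>N))"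
proof -
  interpret N: sigma_finite_measure N by (rule N)
  interpret P: pair_sigma_finite N lborel ..
  have [measurable]: "w \<in> borel_measurable N"
    using w_int by auto
  let ?G = "\<lambda>t. exp (- t\<^sup>2 / (2 * s\<^sup>2)) :: real"
  let ?h = "\<lambda>\<omega> t. complex_of_real (w \<omega>) * (exp (\<i> * complex_of_real (t * (X \<omega> - x))) * complex_of_real (?G t))"
  have norm_h: "norm (?h \<omega> t) = \<bar>w \<omega>\<bar> * ?G t" for \<omega> t
    by (simp add: norm_mult)
  have h_int: "integrable (N \<Otimes>\<^sub>M lborel) (\<lambda>(\<omega>, t). ?h \<omega> t)"
  proof (rule P.Fubini_integrable)
    show "integrable N (\<lambda>\<omega>. \<integral>t. norm (case (\<omega>, t) of (\<omega>, t) \<Rightarrow> ?h \<omega> t) \<partial>lborel)"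
      unfolding split_conv norm_h using w_int by (simp add: gaussian_integrable[OF s])
    show "AE \<omega> in N. integrable lborel (\<lambda>t. case (\<omega>, t) of (\<omega>, t) \<Rightarrow> ?h \<omega> t)"
    proof (rule AE_I2)
      fix \<omega>
      have "integrable lborel (\<lambda>t. \<bar>w \<omega>\<bar> * ?G t)"
        using gaussian_integrable[OF s] by simp
      then show "integrable lborel (\<lambda>t. case (\<omega>, t) of (\<omega>, t) \<Rightarrow> ?h \<omega> t)"
        by (rule Bochner_Integration.integrable_bound) (auto simp: norm_mult)
    qed
  qed measurable
  have "(\<integral>t. (\<integral>\<omega>. ?h \<omega> t \<partial>N) \<partial>lborel) = (\<integral>\<omega>. (\<integral>t. ?h \<omega> t \<partial>lborel) \<partial>N)"
    by (rule P.Fubini_integral[OF h_int])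
  also have "\<dots> = (\<integral>\<omega>. complex_of_real (w \<omega> * (sqrt (2 * pi) * s * exp (- s\<^sup>2 * (x - X \<omega>)\<^sup>2 / 2))) \<partial>N)"
    unfolding integral_mult_right_zero gaussian_fourier[OF s]
    by (simp add: power2_commute)
  also have "\<dots> = complex_of_real (sqrt (2 * pi) * s * (\<integral>\<omega>. w \<omega> * exp (- s\<^sup>2 * (x - X \<omega>)\<^sup>2 / 2) \<partial>N))"
    unfolding integral_complex_of_real integral_mult_right_zero[symmetric]
    by (intro arg_cong[where f = of_real] Bochner_Integration.integral_cong) auto
  finally have "(\<integral>t. (\<integral>\<omega>. ?h \<omega> t \<partial>N) \<partial>lborel) = \<dots>" .
  moreover have "(\<integral>\<omega>. ?h \<omega> t \<partial>N) = (\<integral>\<omega>. complex_of_real (w \<omega>) * exp (\<i> * complex_of_real (t * X \<omega>)) \<partial>N) *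
            exp (- (\<i> * complex_of_real (t * x))) * complex_of_real (?G t)" for t
    unfolding integral_mult_left_zero[symmetric]
    by (intro Bochner_Integration.integral_cong)
       (auto simp: right_diff_distrib exp_diff exp_minus field_simps)
  ultimately show ?thesis by simp
qed

text \<open>Mass at distance at least \<open>\<eta>\<close> from \<open>x\<close> is invisible to the smoothing at \<open>x\<close> in the limit. This is what
  removes the atom at \<open>0\<close> and the linear term of the exponential series from the inversion formula.\<close>

lemma gaussian_smoothing_away:
  fixes w X :: "'a \<Rightarrow> real"
  assumes w_int: "integrable N w" and [measurable]: "X \<in> borel_measurable N"
    and \<eta>: "0 < \<eta>" and away: "\<And>\<omega>. w \<omega> \<noteq> 0 \<Longrightarrow> \<eta> \<le> \<bar>x - X \<omega>\<bar>"
  shows "(\<lambda>n. sqrt (2 * pi) * real (Suc n) * (\<integral>\<omega>. w \<omega> * exp (- (real (Suc n))\<^sup>2 * (x - X \<omega>)\<^sup>2 / 2) \<partial>N)) \<longlonglongrightarrow> 0"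
proof (rule Lim_null_comparison)
  have [measurable]: "w \<in> borel_measurable N"
    using w_int by auto
  let ?A = "\<integral>\<omega>. \<bar>w \<omega>\<bar> \<partial>N"
  let ?E = "\<lambda>n. exp (- (real (Suc n))\<^sup>2 * \<eta>\<^sup>2 / 2)"
  show "\<forall>\<^sub>F n in sequentially. norm (sqrt (2 * pi) * real (Suc n) * (\<integral>\<omega>. w \<omega> * exp (- (real (Suc n))\<^sup>2 * (x - X \<omega>)\<^sup>2 / 2) \<partial>N))
      \<le> sqrt (2 * pi) * real (Suc n) * (?A * ?E n)"
  proof (rule always_eventually, rule allI)
    fix n
    \<comment> \<open>Where the weight vanishes there is no lower bound on the distance, but nothing to estimate either.\<close>
    have bound: "norm (w \<omega> * exp (- (real (Suc n))\<^sup>2 * (x - X \<omega>)\<^sup>2 / 2)) \<le> \<bar>w \<omega>\<bar> * ?E n" for \<omega>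
    proof (cases "w \<omega> = 0")
      case False
      from away[OF this] \<eta> have "\<eta>\<^sup>2 \<le> (x - X \<omega>)\<^sup>2"
        by (metis abs_le_square_iff abs_of_pos)
      then have "exp (- (real (Suc n))\<^sup>2 * (x - X \<omega>)\<^sup>2 / 2) \<le> ?E n"
        by (simp add: mult_left_mono)
      then show ?thesis
        by (simp add: abs_mult mult_left_mono)
    qed simp
    have "norm (\<integral>\<omega>. w \<omega> * exp (- (real (Suc n))\<^sup>2 * (x - X \<omega>)\<^sup>2 / 2) \<partial>N) \<le> (\<integral>\<omega>. \<bar>w \<omega>\<bar> * ?E n \<partial>N)"
      by (rule norm_integral_le) (use w_int bound in auto)
    then have "norm (\<integral>\<omega>. w \<omega> * exp (- (real (Suc n))\<^sup>2 * (x - X \<omega>)\<^sup>2 / 2) \<partial>N) \<le> ?A * ?E n"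
      by simp
    then have "(sqrt (2 * pi) * real (Suc n)) * norm (\<integral>\<omega>. w \<omega> * exp (- (real (Suc n))\<^sup>2 * (x - X \<omega>)\<^sup>2 / 2) \<partial>N)
       \<le> (sqrt (2 * pi) * real (Suc n)) * (?A * ?E n)"
      by (rule mult_left_mono) simp
    then show "norm (sqrt (2 * pi) * real (Suc n) * (\<integral>\<omega>. w \<omega> * exp (- (real (Suc n))\<^sup>2 * (x - X \<omega>)\<^sup>2 / 2) \<partial>N))
      \<le> sqrt (2 * pi) * real (Suc n) * (?A * ?E n)"
      by (simp only: norm_mult real_norm_def abs_mult) (simp add: mult.assoc)
  qed
  have "(\<lambda>n. real (Suc n) * ?E n) \<longlonglongrightarrow> 0"
    using \<eta> by real_asymp
  from tendsto_mult_left[OF this, of "sqrt (2 * pi) * ?A"]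
  show "(\<lambda>n. sqrt (2 * pi) * real (Suc n) * (?A * ?E n)) \<longlonglongrightarrow> 0"
    by (simp add: ac_simps)
qed

text \<open>After the substitution \<open>y = x + v / n\<close> the kernel no longer depends on \<open>n\<close> and dominated
  convergence applies. The factor \<open>2 * pi\<close> is the one of Fourier inversion.\<close>

lemma gaussian_approximate_identity:
  fixes F :: "real \<Rightarrow> real"
  assumes [measurable]: "F \<in> borel_measurable borel" and bounded: "\<And>y. \<bar>F y\<bar> \<le> K"
    and cont: "isCont F x"
  shows "(\<lambda>n. sqrt (2 * pi) * real (Suc n) * (\<integral>y. F y * exp (- (real (Suc n))\<^sup>2 * (x - y)\<^sup>2 / 2) \<partial>lborel))
    \<longlonglongrightarrow> 2 * pi * F x"
proof -
  have scale: "real (Suc n) * (\<integral>y. F y * exp (- (real (Suc n))\<^sup>2 * (x - y)\<^sup>2 / 2) \<partial>lborel)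
      = (\<integral>v. F (x + v / real (Suc n)) * exp (- v\<^sup>2 / 2) \<partial>lborel)" for n
  proof -
    let ?s = "real (Suc n)"
    have s: "?s > 0" by simp
    have "(\<integral>y. F y * exp (- ?s\<^sup>2 * (x - y)\<^sup>2 / 2) \<partial>lborel)
        = (1 / ?s) * (\<integral>v. F (x + 1 / ?s * v) * exp (- ?s\<^sup>2 * (x - (x + 1 / ?s * v))\<^sup>2 / 2) \<partial>lborel)"
      using s by (subst lborel_integral_real_affine[where c = "1 / ?s" and t = x])
        (auto simp del: of_nat_Suc)
    also have "(\<integral>v. F (x + 1 / ?s * v) * exp (- ?s\<^sup>2 * (x - (x + 1 / ?s * v))\<^sup>2 / 2) \<partial>lborel)
        = (\<integral>v. F (x + v / ?s) * exp (- v\<^sup>2 / 2) \<partial>lborel)"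
      using s by (intro Bochner_Integration.integral_cong) (auto simp: power_divide simp del: of_nat_Suc)
    finally show ?thesis using s by (simp del: of_nat_Suc)
  qed
  have gi: "integrable lborel (\<lambda>v. exp (- v\<^sup>2 / 2) :: real)" "(\<integral>v. exp (- v\<^sup>2 / 2) \<partial>lborel) = sqrt (2 * pi)"
    using gaussian_integrable[of 1] by auto
  have "(\<lambda>n. \<integral>v. F (x + v / real (Suc n)) * exp (- v\<^sup>2 / 2) \<partial>lborel) \<longlonglongrightarrow> (\<integral>v. F x * exp (- v\<^sup>2 / 2) \<partial>lborel)"
  proof (rule integral_dominated_convergence[where w = "\<lambda>v. K * exp (- v\<^sup>2 / 2)"])
    show "integrable lborel (\<lambda>v. K * exp (- v\<^sup>2 / 2))"
      using gi by simp
    show "AE v in lborel. (\<lambda>n. F (x + v / real (Suc n)) * exp (- v\<^sup>2 / 2)) \<longlonglongrightarrow> F x * exp (- v\<^sup>2 / 2)"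
    proof (rule AE_I2, rule tendsto_mult_right)
      fix v :: real
      have "(\<lambda>n. x + v / real (Suc n)) \<longlonglongrightarrow> x"
        by real_asymp
      then show "(\<lambda>n. F (x + v / real (Suc n))) \<longlonglongrightarrow> F x"
        by (rule isCont_tendsto_compose[OF cont])
    qed
    show "AE v in lborel. norm (F (x + v / real (Suc n)) * exp (- v\<^sup>2 / 2)) \<le> K * exp (- v\<^sup>2 / 2)" for n
      using bounded by (auto simp: abs_mult intro!: AE_I2 mult_right_mono)
  qed measurable
  then have "(\<lambda>n. sqrt (2 * pi) * (\<integral>v. F (x + v / real (Suc n)) * exp (- v\<^sup>2 / 2) \<partial>lborel)) \<longlonglongrightarrow> sqrt (2 * pi) * (F x * sqrt (2 * pi))"
    using gi by (intro tendsto_mult_left) simp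
  moreover have "sqrt (2 * pi) * (F x * sqrt (2 * pi)) = 2 * pi * F x"
    by (simp add: algebra_simps)
  ultimately show ?thesis
    by (simp only: mult.assoc scale)
qed

text \<open>The half of Plancherel's theorem that is needed, for a bounded nonnegative function. The square
  \<open>(norm (V t))\<^sup>2\<close> is the Fourier transform of \<open>v x * v y\<close> under the difference \<open>x - y\<close>; so its Gaussian
  damping equals a smoothed double integral, in which bounding one factor by \<open>K\<close> leaves the total
  mass \<open>2 * pi\<close> of the kernel. Fatou's lemma removes the damping.\<close>

lemma fourier_sq_bound:
  fixes v :: "real \<Rightarrow> real"
  assumes v_int: "integrable lborel v" and nonneg: "\<And>x. 0 \<le> v x" and le: "\<And>x. v x \<le> K"
  defines "V \<equiv> \<lambda>t. \<integral>x. complex_of_real (v x) * exp (\<i> * complex_of_real (t * x)) \<partial>lborel"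
  shows "integrable lborel (\<lambda>t. (norm (V t))\<^sup>2)"
    and "(\<integral>t. (norm (V t))\<^sup>2 \<partial>lborel) \<le> 2 * pi * K * integral\<^sup>L lborel v"
proof -
  have [measurable]: "v \<in> borel_measurable borel"
    using v_int by auto
  have V_meas [measurable]: "V \<in> borel_measurable borel"
    unfolding V_def by measurable
  let ?N = "lborel \<Otimes>\<^sub>M lborel :: (real \<times> real) measure"
  let ?w = "\<lambda>p :: real \<times> real. v (fst p) * v (snd p)" and ?X = "\<lambda>p :: real \<times> real. fst p - snd p"
  have N: "sigma_finite_measure ?N"
    unfolding lborel_prod by (rule sigma_finite_lborel)
  have w_int: "integrable ?N ?w"
    by (rule lborel_pair.Fubini_integrable) (use v_int in \<open>auto simp: abs_mult\<close>)
  have K: "0 \<le> K"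
    using nonneg[of 0] le[of 0] by linarith
  have V_bound: "norm (V t) \<le> integral\<^sup>L lborel v" for t
    unfolding V_def by (rule norm_integral_le) (use v_int nonneg in \<open>auto simp: norm_mult\<close>)
  have square: "(\<integral>p. complex_of_real (?w p) * exp (\<i> * complex_of_real (t * ?X p)) \<partial>?N)
      = complex_of_real ((norm (V t))\<^sup>2)" for t
  proof -
    let ?e = "\<lambda>t x. complex_of_real (v x) * exp (\<i> * complex_of_real (t * x))"
    have e_int: "integrable lborel (?e t)" for t
      by (rule Bochner_Integration.integrable_bound[OF v_int]) (auto simp: norm_mult)
    have prod_int: "integrable ?N (\<lambda>(x, y). ?e t x * ?e (- t) y)"
      by (rule Bochner_Integration.integrable_bound[OF w_int])
         (auto simp: norm_mult split_beta)
    have cnj_V: "(\<integral>y. ?e (- t) y \<partial>lborel) = cnj (V t)"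
    proof -
      have "(\<integral>y. ?e (- t) y \<partial>lborel) = (\<integral>y. cnj (?e t y) \<partial>lborel)"
        by (intro Bochner_Integration.integral_cong) (auto simp: exp_cnj)
      also have "\<dots> = cnj (V t)"
        unfolding V_def by (rule Bochner_Integration.integral_cnj)
      finally show ?thesis .
    qed
    have "(\<integral>p. complex_of_real (?w p) * exp (\<i> * complex_of_real (t * ?X p)) \<partial>?N)
      = (\<integral>p. (case p of (x, y) \<Rightarrow> ?e t x * ?e (- t) y) \<partial>?N)"
      by (intro Bochner_Integration.integral_cong)
         (auto simp: split_beta right_diff_distrib exp_diff exp_minus field_simps)
    also have "\<dots> = (\<integral>x. (\<integral>y. ?e t x * ?e (- t) y \<partial>lborel) \<partial>lborel)"
      by (rule lborel_pair.integral_fst'[OF prod_int, unfolded split_conv, symmetric])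
    also have "\<dots> = V t * cnj (V t)"
      unfolding integral_mult_right_zero integral_mult_left_zero cnj_V by (simp add: V_def)
    finally show ?thesis
      by (simp only: complex_norm_square)
  qed
  have smoothed: "(\<integral>t. (norm (V t))\<^sup>2 * exp (- t\<^sup>2 / (2 * s\<^sup>2)) \<partial>lborel) \<le> 2 * pi * K * integral\<^sup>L lborel v"
    if s: "0 < s" for s
  proof -
    let ?k = "\<lambda>a. exp (- s\<^sup>2 * a\<^sup>2 / 2) :: real"
    have k: "integrable lborel (\<lambda>y. ?k (0 - (x - y)))" "(\<integral>y. ?k (0 - (x - y)) \<partial>lborel) = sqrt (2 * pi) / s" for x
    proof -
      have eq: "?k (0 - (x - y)) = sqrt (2 * pi) / s * normal_density x (1 / s) y" for y
        using s by (simp add: normal_density_def real_sqrt_mult real_sqrt_divide field_simps power2_commute)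
      show "integrable lborel (\<lambda>y. ?k (0 - (x - y)))" "(\<integral>y. ?k (0 - (x - y)) \<partial>lborel) = sqrt (2 * pi) / s"
        unfolding eq using s by simp_all
    qed
    have "complex_of_real (\<integral>t. (norm (V t))\<^sup>2 * exp (- t\<^sup>2 / (2 * s\<^sup>2)) \<partial>lborel)
       = (\<integral>t. complex_of_real ((norm (V t))\<^sup>2) * exp (- (\<i> * complex_of_real (t * 0))) * complex_of_real (exp (- t\<^sup>2 / (2 * s\<^sup>2))) \<partial>lborel)"
      unfolding integral_complex_of_real[symmetric]
      by (intro Bochner_Integration.integral_cong) auto
    also have "\<dots> = complex_of_real (sqrt (2 * pi) * s * (\<integral>p. ?w p * ?k (0 - ?X p) \<partial>?N))"
      unfolding square[symmetric] by (rule gaussian_smoothing[OF N s w_int]) simp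
    finally have "(\<integral>t. (norm (V t))\<^sup>2 * exp (- t\<^sup>2 / (2 * s\<^sup>2)) \<partial>lborel) = sqrt (2 * pi) * s * (\<integral>p. ?w p * ?k (0 - ?X p) \<partial>?N)"
      by (simp only: of_real_eq_iff)
    also have "(\<integral>p. ?w p * ?k (0 - ?X p) \<partial>?N) = (\<integral>x. (\<integral>y. v x * v y * ?k (0 - (x - y)) \<partial>lborel) \<partial>lborel)"
    proof -
      have "integrable ?N (\<lambda>(x, y). v x * v y * ?k (0 - (x - y)))"
      proof (rule Bochner_Integration.integrable_bound[OF w_int])
        show "AE p in ?N. norm (case p of (x, y) \<Rightarrow> v x * v y * ?k (0 - (x - y))) \<le> norm (?w p)"
          using nonneg by (auto intro!: AE_I2 simp: abs_mult mult_left_le)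
      qed measurable
      from lborel_pair.integral_fst'[OF this] show ?thesis
        by (simp add: case_prod_beta')
    qed
    also have "\<dots> \<le> (\<integral>x. v x * (K * (sqrt (2 * pi) / s)) \<partial>lborel)"
    proof (rule integral_mono_AE')
      show "integrable lborel (\<lambda>x. v x * (K * (sqrt (2 * pi) / s)))"
        using v_int by simp
      show "AE x in lborel. (\<integral>y. v x * v y * ?k (0 - (x - y)) \<partial>lborel) \<le> v x * (K * (sqrt (2 * pi) / s))"
      proof (rule AE_I2)
        fix x
        have "(\<integral>y. v y * ?k (0 - (x - y)) \<partial>lborel) \<le> (\<integral>y. K * ?k (0 - (x - y)) \<partial>lborel)"
          by (rule integral_mono_AE') (use k le K nonneg in \<open>auto intro!: AE_I2 mult_right_mono\<close>)
        then have "(\<integral>y. v y * ?k (0 - (x - y)) \<partial>lborel) \<le> K * (sqrt (2 * pi) / s)"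
          unfolding integral_mult_right_zero k .
        then show "(\<integral>y. v x * v y * ?k (0 - (x - y)) \<partial>lborel) \<le> v x * (K * (sqrt (2 * pi) / s))"
          unfolding mult.assoc integral_mult_right_zero by (intro mult_left_mono nonneg)
      qed
      show "AE x in lborel. 0 \<le> v x * (K * (sqrt (2 * pi) / s))"
        using nonneg K s by auto
    qed
    finally have "(\<integral>t. (norm (V t))\<^sup>2 * exp (- t\<^sup>2 / (2 * s\<^sup>2)) \<partial>lborel)
        \<le> sqrt (2 * pi) * s * (integral\<^sup>L lborel v * (K * (sqrt (2 * pi) / s)))"
      using s by simp
    also have "\<dots> = 2 * pi * K * integral\<^sup>L lborel v"
      using s by simp
    finally show ?thesis .
  qed
  let ?R = "2 * pi * K * integral\<^sup>L lborel v"
  have "(\<integral>\<^sup>+t. ennreal ((norm (V t))\<^sup>2) \<partial>lborel)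
      = (\<integral>\<^sup>+t. liminf (\<lambda>n. ennreal ((norm (V t))\<^sup>2 * exp (- t\<^sup>2 / (2 * (real (Suc n))\<^sup>2)))) \<partial>lborel)"
  proof (rule nn_integral_cong)
    fix t
    have "(\<lambda>n. exp (- t\<^sup>2 / (2 * (real (Suc n))\<^sup>2))) \<longlonglongrightarrow> 1"
      by real_asymp
    then have "(\<lambda>n. ennreal ((norm (V t))\<^sup>2 * exp (- t\<^sup>2 / (2 * (real (Suc n))\<^sup>2)))) \<longlonglongrightarrow> ennreal ((norm (V t))\<^sup>2 * 1)"
      by (intro tendsto_ennrealI tendsto_mult_left)
    then have "liminf (\<lambda>n. ennreal ((norm (V t))\<^sup>2 * exp (- t\<^sup>2 / (2 * (real (Suc n))\<^sup>2)))) = ennreal ((norm (V t))\<^sup>2 * 1)"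
      by (rule lim_imp_Liminf[rotated]) simp
    then show "ennreal ((norm (V t))\<^sup>2) = liminf (\<lambda>n. ennreal ((norm (V t))\<^sup>2 * exp (- t\<^sup>2 / (2 * (real (Suc n))\<^sup>2))))"
      by (simp only: mult_1_right)
  qed
  also have "\<dots> \<le> liminf (\<lambda>n. \<integral>\<^sup>+t. ennreal ((norm (V t))\<^sup>2 * exp (- t\<^sup>2 / (2 * (real (Suc n))\<^sup>2))) \<partial>lborel)"
    by (rule nn_integral_liminf) measurable
  also have "\<dots> \<le> ennreal ?R"
  proof (rule Liminf_le[OF sequentially_bot always_eventually], rule allI)
    fix n
    let ?s = "real (Suc n)"
    have s: "0 < ?s" by simp
    have "integrable lborel (\<lambda>t. (norm (V t))\<^sup>2 * exp (- t\<^sup>2 / (2 * ?s\<^sup>2)))"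
    proof (rule Bochner_Integration.integrable_bound)
      show "integrable lborel (\<lambda>t. (integral\<^sup>L lborel v)\<^sup>2 * exp (- t\<^sup>2 / (2 * ?s\<^sup>2)))"
        by (intro integrable_mult_right gaussian_integrable s)
      show "AE t in lborel. norm ((norm (V t))\<^sup>2 * exp (- t\<^sup>2 / (2 * ?s\<^sup>2)))
          \<le> norm ((integral\<^sup>L lborel v)\<^sup>2 * exp (- t\<^sup>2 / (2 * ?s\<^sup>2)))"
        using V_bound by (auto intro!: AE_I2 mult_right_mono power_mono simp: abs_mult)
    qed measurable
    then have "(\<integral>\<^sup>+t. ennreal ((norm (V t))\<^sup>2 * exp (- t\<^sup>2 / (2 * ?s\<^sup>2))) \<partial>lborel)
        = ennreal (\<integral>t. (norm (V t))\<^sup>2 * exp (- t\<^sup>2 / (2 * ?s\<^sup>2)) \<partial>lborel)"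
      by (rule nn_integral_eq_integral) auto
    then show "(\<integral>\<^sup>+t. ennreal ((norm (V t))\<^sup>2 * exp (- t\<^sup>2 / (2 * ?s\<^sup>2))) \<partial>lborel) \<le> ennreal ?R"
      using smoothed[OF s] by (simp add: ennreal_leI del: of_nat_Suc)
  qed
  finally have bound: "(\<integral>\<^sup>+t. ennreal ((norm (V t))\<^sup>2) \<partial>lborel) \<le> ennreal ?R" .
  show int: "integrable lborel (\<lambda>t. (norm (V t))\<^sup>2)"
    by (rule integrableI_bounded) (use bound in \<open>auto intro: le_less_trans\<close>)
  have "ennreal (\<integral>t. (norm (V t))\<^sup>2 \<partial>lborel) \<le> ennreal ?R"
    using bound nn_integral_eq_integral[OF int] by simp
  then show "(\<integral>t. (norm (V t))\<^sup>2 \<partial>lborel) \<le> ?R"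
    by (rule ennreal_le_iff[THEN iffD1, rotated])
       (use K nonneg in \<open>auto intro!: mult_nonneg_nonneg integral_nonneg_AE\<close>)
qed

section \<open>The intensity and its transform\<close>

text \<open>Here \<open>w\<close> is the intensity extended by zero outside \<open>{0..1}\<close>. The normalisation \<open>\<epsilon> \<le> 1 / 2\<close> keeps the
  interval on which \<open>w\<close> is bounded below inside \<open>{1/2..1}\<close>.\<close>

locale levy_intensity =
  fixes w :: "real \<Rightarrow> real" and \<epsilon> B :: real
  assumes w_meas [measurable]: "w \<in> borel_measurable borel"
    and w_nonneg: "0 \<le> w x" and w_le: "w x \<le> B"
    and w_support: "x \<notin> {0..1} \<Longrightarrow> w x = 0"
    and \<epsilon>_pos: "0 < \<epsilon>" and \<epsilon>_le: "\<epsilon> \<le> 1 / 2"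
    and w_lower: "x \<in> {1 - \<epsilon>..1} \<Longrightarrow> \<epsilon> \<le> w x"
begin

text \<open>The derivatives of \<open>H\<close> on the real line: \<open>mom 0 b - mom 0 0\<close> is the cumulant generating function of \<open>T\<close>,
  and \<open>mom k b\<close> for \<open>k \<ge> 1\<close> is the \<open>k\<close>-th cumulant of \<open>T\<close> under the law tilted by \<open>b\<close>.\<close>

definition mom :: "nat \<Rightarrow> real \<Rightarrow> real" where
  "mom k b = (\<integral>x. w x * x ^ k * exp (b * x) \<partial>lborel)"

definition transform :: "real \<Rightarrow> real \<Rightarrow> complex" where
  "transform b t = cmgf lborel w (\<lambda>x. x) (Complex b t)"

lemma B_nonneg: "0 \<le> B"
  using w_nonneg[of 0] w_le[of 0] by linarith

lemma integrable_w_mult: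
  fixes h :: "real \<Rightarrow> 'b :: {banach, second_countable_topology, real_normed_algebra_1}"
  assumes [measurable]: "h \<in> borel_measurable borel"
    and le: "\<And>x. 0 \<le> x \<Longrightarrow> x \<le> 1 \<Longrightarrow> norm (h x) \<le> K"
  shows "integrable lborel (\<lambda>x. of_real (w x) * h x)"
proof (rule Bochner_Integration.integrable_bound)
  show "integrable lborel (\<lambda>x :: real. B * K * indicator {0..1} x :: real)"
    by (intro integrable_mult_right integrable_real_indicator) auto
  show "AE x in lborel. norm (of_real (w x) * h x) \<le> norm (B * K * indicator {0..1} x :: real)"
  proof (rule AE_I2)
    fix x
    show "norm (of_real (w x) * h x) \<le> norm (B * K * indicator {0..1} x :: real)"
    proof (cases "x \<in> {0..1}")
      case True
      then have h: "norm (h x) \<le> K" using le by auto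
      have "norm (of_real (w x) * h x) \<le> norm (of_real (w x) :: 'b) * norm (h x)"
        by (rule norm_mult_ineq)
      also have "\<dots> \<le> B * K"
        using w_nonneg[of x] w_le[of x] h by (intro mult_mono B_nonneg) auto
      also have "\<dots> \<le> norm (B * K * indicator {0..1} x)"
        using True by simp
      finally show ?thesis .
    qed (simp add: w_support)
  qed
qed measurable

lemma exp_mult_le: "0 \<le> x \<Longrightarrow> x \<le> 1 \<Longrightarrow> exp (b * x) \<le> exp \<bar>b\<bar>" for b x :: real
  by (smt (verit) exp_le_cancel_iff mult_left_le mult_mono mult_nonneg_nonneg)

lemma mom_integrable: "integrable lborel (\<lambda>x. w x * x ^ k * exp (b * x))"
proof -
  have "integrable lborel (\<lambda>x. of_real (w x) * (x ^ k * exp (b * x)))"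
  proof (rule integrable_w_mult)
    fix x :: real assume x: "0 \<le> x" "x \<le> 1"
    have "x ^ k * exp (b * x) \<le> 1 * exp \<bar>b\<bar>"
      using x exp_mult_le[OF x, of b] by (intro mult_mono power_le_one) auto
    then show "norm (x ^ k * exp (b * x)) \<le> exp \<bar>b\<bar>"
      using x by (simp add: abs_mult)
  qed measurable
  then show ?thesis by (simp add: mult.assoc)
qed

lemma mom_has_real_derivative: "(mom k has_real_derivative mom (Suc k) b) (at b)"
proof -
  have "((\<lambda>\<theta>. \<integral>x. w x * x ^ k * exp (\<theta> * x) \<partial>lborel) has_real_derivative
     (\<integral>x. (w x * x ^ k * x) * exp (b * x) \<partial>lborel)) (at b)"
    by (rule mgf_has_real_derivative) (use mom_integrable in auto)
  then show ?thesis
    unfolding mom_def by (simp add: ac_simps)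
qed

lemma mom_nonneg: "0 \<le> mom k b"
  unfolding mom_def
proof (rule integral_nonneg_AE, rule AE_I2)
  fix x show "0 \<le> w x * x ^ k * exp (b * x)"
    using w_nonneg[of x] w_support[of x] by (cases "x \<in> {0..1}") auto
qed

lemma mom_Suc_le: "mom (Suc k) b \<le> mom k b"
  unfolding mom_def
proof (rule integral_mono[OF mom_integrable mom_integrable])
  fix x
  show "w x * x ^ Suc k * exp (b * x) \<le> w x * x ^ k * exp (b * x)"
    using w_nonneg[of x] w_support[of x]
    by (cases "x \<in> {0..1}") (auto intro!: mult_right_mono mult_left_mono mult_left_le_one_le)
qed

lemma mom_le_mom_1: "mom (Suc k) b \<le> mom 1 b"
proof (induction k)
  case (Suc k)
  then show ?case using mom_Suc_le[of "Suc k" b] by linarith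
qed simp

lemma mom_mono:
  assumes "b \<le> c" shows "mom k b \<le> mom k c"
  unfolding mom_def
proof (rule integral_mono[OF mom_integrable mom_integrable])
  fix x
  show "w x * x ^ k * exp (b * x) \<le> w x * x ^ k * exp (c * x)"
    using w_nonneg[of x] w_support[of x] assms
    by (cases "x \<in> {0..1}") (auto intro!: mult_left_mono mult_right_mono)
qed

lemma mom_le:
  assumes "0 \<le> b" shows "mom k b \<le> B * exp b"
proof -
  have "mom k b \<le> (\<integral>x. B * exp b * indicator {0..1 :: real} x \<partial>lborel)"
    unfolding mom_def
  proof (rule integral_mono[OF mom_integrable])
    show "integrable lborel (\<lambda>x :: real. B * exp b * indicator {0..1} x :: real)"
      by (intro integrable_mult_right integrable_real_indicator) auto
    fix x
    show "w x * x ^ k * exp (b * x) \<le> B * exp b * indicator {0..1} x"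
    proof (cases "x \<in> {0..1}")
      case True
      then have "w x * (x ^ k * exp (b * x)) \<le> B * (1 * exp b)"
        using w_nonneg[of x] w_le[of x] exp_mult_le[of x b] assms B_nonneg
        by (intro mult_mono power_le_one) (auto)
      then show ?thesis using True by (simp add: mult.assoc)
    qed (simp add: w_support)
  qed
  then show ?thesis by simp
qed

lemma cmgf_w_of_real: "cmgf lborel w (\<lambda>x. x) (complex_of_real b) = complex_of_real (mom 0 b)"
  unfolding cmgf_def mom_def integral_complex_of_real[symmetric]
  by (intro Bochner_Integration.integral_cong) (auto simp flip: exp_of_real)

lemma transform_alt: "transform b t = (\<integral>x. complex_of_real (w x * exp (b * x)) * exp (\<i> * complex_of_real (t * x)) \<partial>lborel)"
  unfolding transform_def cmgf_def
  by (intro Bochner_Integration.integral_cong)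
     (auto simp: Complex_eq ring_distribs ac_simps simp flip: exp_add exp_of_real)

lemma transform_measurable [measurable]: "transform b \<in> borel_measurable borel"
  unfolding transform_alt[abs_def] by measurable

lemma norm_transform_le: "norm (transform b t) \<le> mom 0 b"
  unfolding transform_alt mom_def
  by (rule norm_integral_le) (use mom_integrable[of 0 b] w_nonneg in \<open>auto simp: norm_mult\<close>)

lemma transform_sq_integrable: "integrable lborel (\<lambda>t. (norm (transform b t))\<^sup>2)"
  and transform_sq_integral: "0 \<le> b \<Longrightarrow> (\<integral>t. (norm (transform b t))\<^sup>2 \<partial>lborel) \<le> 2 * pi * (B * exp b)\<^sup>2"
proof -
  have int: "integrable lborel (\<lambda>x. w x * exp (b * x))"
    using mom_integrable[of 0 b] by simp
  have le: "w x * exp (b * x) \<le> B * exp \<bar>b\<bar>" for x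
  proof (cases "x \<in> {0..1}")
    case True
    then show ?thesis
      using w_nonneg[of x] w_le[of x] exp_mult_le[of x b] by (intro mult_mono B_nonneg) auto
  qed (use B_nonneg in \<open>simp add: w_support\<close>)
  note fourier_sq_bound[OF int _ le, folded transform_alt]
  note bnd = this
  show "integrable lborel (\<lambda>t. (norm (transform b t))\<^sup>2)"
    by (rule bnd) (simp add: w_nonneg)
  assume b: "0 \<le> b"
  have "(\<integral>t. (norm (transform b t))\<^sup>2 \<partial>lborel) \<le> 2 * pi * (B * exp \<bar>b\<bar>) * (\<integral>x. w x * exp (b * x) \<partial>lborel)"
    by (rule bnd) (simp add: w_nonneg)
  also have "\<dots> \<le> 2 * pi * (B * exp b) * (B * exp b)"
    using mom_le[OF b, of 0] b B_nonneg by (auto simp: mom_def intro!: mult_left_mono)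
  finally show "(\<integral>t. (norm (transform b t))\<^sup>2 \<partial>lborel) \<le> 2 * pi * (B * exp b)\<^sup>2"
    by (simp add: power2_eq_square ac_simps)
qed

text \<open>The exponential series of the transform without the terms of order zero and one: on the line
  \<open>Re z = b\<close> the former is constant, and the latter is not integrable when \<open>w\<close> jumps.\<close>

definition residual :: "real \<Rightarrow> real \<Rightarrow> complex" where
  "residual b t = exp (transform b t) - 1 - transform b t"

lemma residual_measurable [measurable]: "residual b \<in> borel_measurable borel"
  unfolding residual_def[abs_def] by measurable

lemma residual_integrable: "integrable lborel (residual b)"
proof (rule Bochner_Integration.integrable_bound)
  show "integrable lborel (\<lambda>t. exp (mom 0 b) * (norm (transform b t))\<^sup>2)"
    by (intro integrable_mult_right transform_sq_integrable)
  show "AE t in lborel. norm (residual b t) \<le> norm (exp (mom 0 b) * (norm (transform b t))\<^sup>2)"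
  proof (rule AE_I2)
    fix t
    have "norm (residual b t) \<le> exp \<bar>Re (transform b t)\<bar> * (norm (transform b t))\<^sup>2"
      unfolding residual_def by (rule norm_exp_remainder)
    also have "\<dots> \<le> exp (mom 0 b) * (norm (transform b t))\<^sup>2"
      using norm_transform_le[of b t] abs_Re_le_cmod[of "transform b t"] by (intro mult_right_mono) auto
    finally show "norm (residual b t) \<le> norm (exp (mom 0 b) * (norm (transform b t))\<^sup>2)"
      by (simp add: abs_mult)
  qed
qed simp

end

section \<open>Inversion formula for the defective density\<close>

lemma defective_density_integral:
  assumes T [measurable]: "T \<in> borel_measurable M" and f: "defective_density M T f"
    and A [measurable]: "A \<in> sets borel" and A_pos: "A \<subseteq> {0<..}"
    and h [measurable]: "h \<in> borel_measurable borel" and h_nonneg: "\<And>y. (0 :: real) \<le> h y"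
  shows "(\<integral>\<omega>. indicator A (T \<omega>) * h (T \<omega>) \<partial>M) = (\<integral>y. indicator A y * f y * h y \<partial>lborel)"
proof -
  from f have f_meas: "(\<lambda>y. indicator {0<..} y *\<^sub>R f y) \<in> borel_measurable borel"
    and f_nonneg: "\<And>y. y > 0 \<Longrightarrow> 0 \<le> f y"
    and f_law: "\<And>A. A \<in> sets borel \<Longrightarrow> A \<subseteq> {0<..} \<Longrightarrow>
        emeasure (distr M borel T) A = (\<integral>\<^sup>+x\<in>A. ennreal (f x) \<partial>lborel)"
    unfolding defective_density_def set_borel_measurable_def by auto
  have eq: "indicator A y * f y = indicator A y * (indicator {0<..} y *\<^sub>R f y)" for y
    using A_pos by (auto split: split_indicator)
  have [measurable]: "(\<lambda>y. indicator A y * f y) \<in> borel_measurable borel"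
    unfolding eq using f_meas by measurable
  have Af_nonneg: "0 \<le> indicator A y * f y" for y
    using A_pos f_nonneg by (auto split: split_indicator)
  have dens: "density (distr M borel T) (indicator A) = density lborel (\<lambda>y. ennreal (indicator A y * f y))"
  proof (rule measure_eqI)
    fix X assume "X \<in> sets (density (distr M borel T) (indicator A))"
    then have X [measurable]: "X \<in> sets borel" by simp
    have "emeasure (density (distr M borel T) (indicator A)) X = emeasure (distr M borel T) (A \<inter> X)"
      by (subst emeasure_density) (auto simp: indicator_inter_arith[symmetric])
    also have "\<dots> = (\<integral>\<^sup>+x\<in>A \<inter> X. ennreal (f x) \<partial>lborel)"
      using A_pos by (intro f_law) auto
    also have "\<dots> = emeasure (density lborel (\<lambda>y. ennreal (indicator A y * f y))) X"
      by (subst emeasure_density) (auto intro!: nn_integral_cong split: split_indicator)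
    finally show "emeasure (density (distr M borel T) (indicator A)) X
        = emeasure (density lborel (\<lambda>y. ennreal (indicator A y * f y))) X" .
  qed simp
  have "(\<integral>\<^sup>+\<omega>. ennreal (indicator A (T \<omega>) * h (T \<omega>)) \<partial>M)
      = (\<integral>\<^sup>+y. ennreal (indicator A y * h y) \<partial>distr M borel T)"
    by (subst nn_integral_distr) auto
  also have "\<dots> = (\<integral>\<^sup>+y. ennreal (h y) \<partial>density (distr M borel T) (indicator A))"
    by (subst nn_integral_density) (auto intro!: nn_integral_cong split: split_indicator)
  also have "\<dots> = (\<integral>\<^sup>+y. ennreal (indicator A y * f y * h y) \<partial>lborel)"
    unfolding dens using Af_nonneg
    by (subst nn_integral_density) (auto intro!: nn_integral_cong simp: ennreal_mult h_nonneg)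
  finally have "(\<integral>\<^sup>+\<omega>. ennreal (indicator A (T \<omega>) * h (T \<omega>)) \<partial>M) = \<dots>" .
  moreover have "(\<integral>\<omega>. indicator A (T \<omega>) * h (T \<omega>) \<partial>M) = enn2real (\<integral>\<^sup>+\<omega>. ennreal (indicator A (T \<omega>) * h (T \<omega>)) \<partial>M)"
    by (rule integral_eq_nn_integral) (auto simp: h_nonneg)
  moreover have "(\<integral>y. indicator A y * f y * h y \<partial>lborel) = enn2real (\<integral>\<^sup>+y. ennreal (indicator A y * f y * h y) \<partial>lborel)"
    by (rule integral_eq_nn_integral) (auto simp: h_nonneg Af_nonneg)
  ultimately show ?thesis by simp
qed

text \<open>Near \<open>x\<close> the law of \<open>T\<close> has the continuous density \<open>f\<close>, so the smoothed law converges to it;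
  everything else, including the atom, lies at a positive distance from \<open>x\<close>.\<close>

lemma smoothed_defective_density:
  fixes T :: "'a \<Rightarrow> real"
  assumes T [measurable]: "T \<in> borel_measurable M" and f: "defective_density M T f"
    and cont: "continuous_on {1<..} f" and x: "1 < x"
    and exp_int: "integrable M (\<lambda>\<omega>. exp (b * T \<omega>))"
  shows "(\<lambda>n. sqrt (2 * pi) * real (Suc n) *
      (\<integral>\<omega>. exp (b * T \<omega>) * exp (- (real (Suc n))\<^sup>2 * (x - T \<omega>)\<^sup>2 / 2) \<partial>M)) \<longlonglongrightarrow> 2 * pi * (exp (b * x) * f x)"
proof -
  define \<eta> where "\<eta> = (x - 1) / 2"
  have \<eta>: "0 < \<eta>" "x - \<eta> > 1" using x by (auto simp: \<eta>_def field_simps)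
  let ?S = "{x - \<eta>..x + \<eta>}"
  let ?k = "\<lambda>n y. exp (- (real (Suc n))\<^sup>2 * (x - y)\<^sup>2 / 2) :: real"
  let ?F = "\<lambda>y. indicator ?S y * f y * exp (b * y)"
  have S_pos: "?S \<subseteq> {0<..}" "?S \<subseteq> {1<..}" using \<eta> by auto
  have contS: "continuous_on ?S (\<lambda>y. f y * exp (b * y))"
    by (intro continuous_intros continuous_on_subset[OF cont S_pos(2)])
  have F_meas: "?F \<in> borel_measurable borel"
    using borel_measurable_continuous_on_indicator[OF _ contS] by (simp add: mult.assoc)
  obtain K where K: "\<And>y. y \<in> ?S \<Longrightarrow> \<bar>f y * exp (b * y)\<bar> \<le> K"
  proof -
    have "bounded ((\<lambda>y. f y * exp (b * y)) ` ?S)"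
      by (intro compact_imp_bounded compact_continuous_image contS) simp
    then obtain K where "\<forall>z\<in>(\<lambda>y. f y * exp (b * y)) ` ?S. norm z \<le> K"
      unfolding bounded_iff by blast
    then have "\<bar>f y * exp (b * y)\<bar> \<le> K" if "y \<in> ?S" for y
      using that by force
    then show ?thesis by (rule that)
  qed
  have F_bound: "\<bar>?F y\<bar> \<le> max K 0" for y
    using K[of y] by (auto split: split_indicator simp: max_def abs_mult)
  have F_cont: "isCont ?F x"
  proof -
    have "continuous_on {x - \<eta><..<x + \<eta>} (\<lambda>y. f y * exp (b * y))"
      by (rule continuous_on_subset[OF contS]) auto
    then have "continuous_on {x - \<eta><..<x + \<eta>} ?F"
      by (rule continuous_on_eq) (auto split: split_indicator)
    then show ?thesis
      using \<eta> by (simp add: continuous_on_eq_continuous_at)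
  qed
  have near: "(\<lambda>n. sqrt (2 * pi) * real (Suc n) * (\<integral>\<omega>. (indicator ?S (T \<omega>) * exp (b * T \<omega>)) * ?k n (T \<omega>) \<partial>M))
      \<longlonglongrightarrow> 2 * pi * (exp (b * x) * f x)"
  proof -
    have transfer: "(\<integral>\<omega>. (indicator ?S (T \<omega>) * exp (b * T \<omega>)) * ?k n (T \<omega>) \<partial>M) = (\<integral>y. ?F y * ?k n y \<partial>lborel)" for n
      using defective_density_integral[OF T f _ S_pos(1), of "\<lambda>y. exp (b * y) * ?k n y"]
      by (simp add: mult.assoc del: of_nat_Suc)
    have Fx: "?F x = exp (b * x) * f x"
      using \<eta> by simp
    show ?thesis
      unfolding transfer Fx[symmetric]
      by (rule gaussian_approximate_identity[OF F_meas F_bound F_cont])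
  qed
  have near_int: "integrable M (\<lambda>\<omega>. indicator ?S (T \<omega>) * exp (b * T \<omega>))"
    by (rule Bochner_Integration.integrable_bound[OF exp_int]) (auto split: split_indicator)
  have far_int: "integrable M (\<lambda>\<omega>. indicator (- ?S) (T \<omega>) * exp (b * T \<omega>))"
    by (rule Bochner_Integration.integrable_bound[OF exp_int]) (auto split: split_indicator)
  have far: "(\<lambda>n. sqrt (2 * pi) * real (Suc n) * (\<integral>\<omega>. (indicator (- ?S) (T \<omega>) * exp (b * T \<omega>)) * ?k n (T \<omega>) \<partial>M))
      \<longlonglongrightarrow> 0"
    by (rule gaussian_smoothing_away[OF far_int T \<eta>(1)]) (auto split: split_indicator_asm)
  have k_int: "integrable M (\<lambda>\<omega>. v \<omega> * ?k n (T \<omega>))" if v: "integrable M v" for v n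
  proof (rule Bochner_Integration.integrable_bound[OF v])
    have [measurable]: "v \<in> borel_measurable M" using v by auto
    show "(\<lambda>\<omega>. v \<omega> * ?k n (T \<omega>)) \<in> borel_measurable M" by measurable
  qed (auto simp: abs_mult mult_left_le)
  have "(\<integral>\<omega>. exp (b * T \<omega>) * ?k n (T \<omega>) \<partial>M)
      = (\<integral>\<omega>. (indicator ?S (T \<omega>) * exp (b * T \<omega>)) * ?k n (T \<omega>) \<partial>M)
        + (\<integral>\<omega>. (indicator (- ?S) (T \<omega>) * exp (b * T \<omega>)) * ?k n (T \<omega>) \<partial>M)" for n
    unfolding Bochner_Integration.integral_add[OF k_int[OF near_int] k_int[OF far_int], symmetric]
    by (intro Bochner_Integration.integral_cong) (auto split: split_indicator)
  then show ?thesis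
    using tendsto_add[OF near far] by (simp add: distrib_left)
qed

context levy_intensity
begin

lemma complex_mgf_eq:
  fixes T :: "'a \<Rightarrow> real"
  assumes T [measurable]: "T \<in> borel_measurable M"
    and exp_int: "\<And>\<theta>. integrable M (\<lambda>\<omega>. exp (\<theta> * T \<omega>))"
    and mgf: "\<And>\<theta>. (\<integral>\<omega>. exp (\<theta> * T \<omega>) \<partial>M) = exp (mom 0 \<theta> - mom 0 0)"
  shows "cmgf M (\<lambda>_. 1) T z = exp (cmgf lborel w (\<lambda>x. x) z - complex_of_real (mom 0 0))"
proof -
  let ?P = "cmgf M (\<lambda>_. 1) T" and ?H = "\<lambda>z. exp (cmgf lborel w (\<lambda>x. x) z - complex_of_real (mom 0 0))"
  have dP: "(?P has_field_derivative cmgf M (\<lambda>\<omega>. 1 * T \<omega>) T z) (at z)" for z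
    by (rule cmgf_has_field_derivative) (use exp_int in auto)
  have dw: "(cmgf lborel w (\<lambda>x. x) has_field_derivative cmgf lborel (\<lambda>x. w x * x) (\<lambda>x. x) z) (at z)" for z
    by (rule cmgf_has_field_derivative) (use mom_integrable[of 0] in auto)
  have holP: "?P holomorphic_on UNIV"
    using dP by (auto simp: holomorphic_on_def field_differentiable_def)
  have holw: "cmgf lborel w (\<lambda>x. x) holomorphic_on UNIV"
    using dw by (auto simp: holomorphic_on_def field_differentiable_def)
  have real: "?P (complex_of_real \<theta>) - ?H (complex_of_real \<theta>) = 0" for \<theta>
  proof -
    have "?P (complex_of_real \<theta>) = complex_of_real (\<integral>\<omega>. exp (\<theta> * T \<omega>) \<partial>M)"
      unfolding cmgf_def integral_complex_of_real[symmetric]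
      by (intro Bochner_Integration.integral_cong) (auto simp flip: exp_of_real)
    then show ?thesis
      unfolding mgf cmgf_w_of_real by (simp flip: exp_of_real)
  qed
  \<comment> \<open>The real axis has a limit point, so two entire functions that agree on it coincide.\<close>
  have lim: "(0 :: complex) islimpt range complex_of_real"
    unfolding islimpt_approachable
  proof (intro allI impI)
    fix e :: real assume "0 < e"
    then show "\<exists>z\<in>range complex_of_real. z \<noteq> 0 \<and> dist z 0 < e"
      by (intro bexI[of _ "complex_of_real (e / 2)"] rangeI) (auto simp: norm_divide)
  qed
  have "?P z - ?H z = 0"
    by (rule analytic_continuation[of "\<lambda>z. ?P z - ?H z" UNIV "range complex_of_real" 0])
       (use holP holw lim real in \<open>auto intro!: holomorphic_intros\<close>)
  then show ?thesis by simp
qed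

text \<open>The value at \<open>x\<close> of the smoothed tilted law splits into three parts according to
  \<open>exp H = 1 + H + residual\<close>. The first is the smoothing of a point mass at \<open>0\<close> and the second that of
  the tilted intensity; both vanish in the limit because \<open>x > 1\<close>. The third converges by dominated
  convergence.\<close>

lemma density_inversion:
  fixes T :: "'a \<Rightarrow> real"
  assumes M: "prob_space M" and T [measurable]: "T \<in> borel_measurable M"
    and exp_int: "\<And>\<theta>. integrable M (\<lambda>\<omega>. exp (\<theta> * T \<omega>))"
    and mgf: "\<And>\<theta>. (\<integral>\<omega>. exp (\<theta> * T \<omega>) \<partial>M) = exp (mom 0 \<theta> - mom 0 0)"
    and f: "defective_density M T f"
    and cont: "continuous_on {1<..} f" and x: "1 < x"
  shows "complex_of_real (2 * pi * (exp (b * x) * f x))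
    = complex_of_real (exp (- mom 0 0)) * (\<integral>t. residual b t * exp (- (\<i> * complex_of_real (t * x))) \<partial>lborel)"
proof -
  interpret prob_space M by (rule M)
  let ?G = "\<lambda>n t. exp (- t\<^sup>2 / (2 * (real (Suc n))\<^sup>2)) :: real"
  let ?e = "\<lambda>t. exp (- (\<i> * complex_of_real (t * x)))"
  let ?I = "\<lambda>h n. \<integral>t. h t * ?e t * complex_of_real (?G n t) \<partial>lborel"
  define A where "A n = sqrt (2 * pi) * real (Suc n) *
      (\<integral>\<omega>. exp (b * T \<omega>) * exp (- (real (Suc n))\<^sup>2 * (x - T \<omega>)\<^sup>2 / 2) \<partial>M)" for n
  define D where "D n = sqrt (2 * pi) * real (Suc n) * exp (- (real (Suc n))\<^sup>2 * x\<^sup>2 / 2)" for n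
  define E where "E n = sqrt (2 * pi) * real (Suc n) *
      (\<integral>y. w y * exp (b * y) * exp (- (real (Suc n))\<^sup>2 * (x - y)\<^sup>2 / 2) \<partial>lborel)" for n
  have s: "0 < real (Suc n)" for n by simp
  have IM: "?I (\<lambda>t. cmgf M (\<lambda>_. 1) T (Complex b t)) n = complex_of_real (A n)" for n
  proof -
    have "cmgf M (\<lambda>_. 1) T (Complex b t)
        = (\<integral>\<omega>. complex_of_real (exp (b * T \<omega>)) * exp (\<i> * complex_of_real (t * T \<omega>)) \<partial>M)" for t
      unfolding cmgf_def
      by (intro Bochner_Integration.integral_cong)
         (auto simp: Complex_eq ring_distribs ac_simps simp flip: exp_add exp_of_real)
    then show ?thesis
      unfolding A_def using gaussian_smoothing[OF sigma_finite_measure_axioms s exp_int T] by simp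
  qed
  have Itr: "?I (transform b) n = complex_of_real (E n)" for n
  proof -
    have "integrable lborel (\<lambda>y. w y * exp (b * y))"
      using mom_integrable[of 0 b] by simp
    from gaussian_smoothing[OF sigma_finite_lborel s this, of "\<lambda>y. y"]
    show ?thesis unfolding E_def transform_alt by simp
  qed
  have I1: "?I (\<lambda>_. 1) n = complex_of_real (D n)" for n
    using gaussian_fourier[OF s, of "- x" n] by (simp add: D_def)
  have split: "cmgf M (\<lambda>_. 1) T (Complex b t) = complex_of_real (exp (- mom 0 0)) * (1 + transform b t + residual b t)" for t
    unfolding complex_mgf_eq[OF T exp_int mgf] residual_def transform_def
    by (simp add: exp_diff exp_minus field_simps exp_of_real)
  have int: "integrable lborel (\<lambda>t. h t * ?e t * complex_of_real (?G n t))"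
    if [measurable]: "h \<in> borel_measurable borel" and h: "\<And>t. norm (h t) \<le> K" for h K n
  proof (rule Bochner_Integration.integrable_bound)
    show "integrable lborel (\<lambda>t. K * ?G n t)"
      by (intro integrable_mult_right gaussian_integrable s)
    have "0 \<le> K" using h[of 0] norm_ge_zero order_trans by blast
    then show "AE t in lborel. norm (h t * ?e t * complex_of_real (?G n t)) \<le> norm (K * ?G n t)"
      using h by (auto simp: norm_mult abs_mult intro!: AE_I2 mult_right_mono)
  qed measurable
  have G_le: "?G n t \<le> 1" for n t by simp
  have intR: "integrable lborel (\<lambda>t. residual b t * ?e t * complex_of_real (?G n t))" for n
    by (rule Bochner_Integration.integrable_bound[OF residual_integrable[of b]])
       (use G_le in \<open>auto simp: norm_mult mult_left_le\<close>)
  \<comment> \<open>\<open>A\<close>, \<open>D\<close>, \<open>E\<close>: smoothings at \<open>x\<close> of the tilted law, of the point mass at \<open>0\<close>, of the tilted intensity\<close>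
  have ADE: "complex_of_real (A n) = complex_of_real (exp (- mom 0 0)) * (complex_of_real (D n) + complex_of_real (E n) + ?I (residual b) n)" for n
  proof -
    have "complex_of_real (A n) = (\<integral>t. complex_of_real (exp (- mom 0 0)) *
        (1 * ?e t * complex_of_real (?G n t) + transform b t * ?e t * complex_of_real (?G n t) + residual b t * ?e t * complex_of_real (?G n t)) \<partial>lborel)"
      unfolding IM[symmetric] split
      by (intro Bochner_Integration.integral_cong) (auto simp: algebra_simps)
    also have "\<dots> = complex_of_real (exp (- mom 0 0)) * (?I (\<lambda>_. 1) n + ?I (transform b) n + ?I (residual b) n)"
    proof -
      have i1: "integrable lborel (\<lambda>t. 1 * ?e t * complex_of_real (?G n t))"
        by (rule int[of _ 1]) auto
      have i2: "integrable lborel (\<lambda>t. transform b t * ?e t * complex_of_real (?G n t))"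
        by (rule int[OF transform_measurable norm_transform_le])
      show ?thesis
        unfolding integral_mult_right_zero
          Bochner_Integration.integral_add[OF Bochner_Integration.integrable_add[OF i1 i2] intR]
          Bochner_Integration.integral_add[OF i1 i2] ..
    qed
    finally show ?thesis unfolding I1 Itr .
  qed
  have "A \<longlonglongrightarrow> 2 * pi * (exp (b * x) * f x)"
    unfolding A_def by (rule smoothed_defective_density[OF T f cont x exp_int])
  then have limA: "(\<lambda>n. complex_of_real (A n)) \<longlonglongrightarrow> complex_of_real (2 * pi * (exp (b * x) * f x))"
    by (rule tendsto_of_real)
  have "D \<longlonglongrightarrow> 0"
    unfolding D_def using x by real_asymp
  moreover have "E \<longlonglongrightarrow> 0"
  proof -
    have "integrable lborel (\<lambda>y. w y * exp (b * y))"
      using mom_integrable[of 0 b] by simp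
    moreover have "x - 1 \<le> \<bar>x - y\<bar>" if "w y * exp (b * y) \<noteq> 0" for y
      using that w_support[of y] by force
    ultimately show ?thesis
      unfolding E_def using gaussian_smoothing_away[of lborel "\<lambda>y. w y * exp (b * y)" "\<lambda>y. y" "x - 1" x] x
      by auto
  qed
  moreover have "(\<lambda>n. ?I (residual b) n) \<longlonglongrightarrow> (\<integral>t. residual b t * ?e t \<partial>lborel)"
  proof (rule integral_dominated_convergence[where w = "\<lambda>t. norm (residual b t)"])
    show "integrable lborel (\<lambda>t. norm (residual b t))"
      using residual_integrable by simp
    show "AE t in lborel. (\<lambda>n. residual b t * ?e t * complex_of_real (?G n t)) \<longlonglongrightarrow> residual b t * ?e t"
    proof (rule AE_I2)
      fix t
      have "(\<lambda>n. ?G n t) \<longlonglongrightarrow> 1" by real_asymp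
      from tendsto_mult_left[OF tendsto_of_real[OF this], of "residual b t * ?e t"]
      show "(\<lambda>n. residual b t * ?e t * complex_of_real (?G n t)) \<longlonglongrightarrow> residual b t * ?e t" by simp
    qed
    show "AE t in lborel. norm (residual b t * ?e t * complex_of_real (?G n t)) \<le> norm (residual b t)" for n
      using G_le by (auto simp: norm_mult mult_left_le)
  qed measurable
  ultimately have "(\<lambda>n. complex_of_real (exp (- mom 0 0)) * (complex_of_real (D n) + complex_of_real (E n) + ?I (residual b) n))
      \<longlonglongrightarrow> complex_of_real (exp (- mom 0 0)) * (complex_of_real 0 + complex_of_real 0 + (\<integral>t. residual b t * ?e t \<partial>lborel))"
    by (intro tendsto_intros)
  from LIMSEQ_unique[OF limA[unfolded ADE] this] show ?thesis
    by (simp only: of_real_0 add_0)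
qed

end

section \<open>Gaussian and exponential moments\<close>

lemma gaussian_moments:
  fixes a :: real
  assumes a: "0 < a"
  shows "has_bochner_integral lborel (\<lambda>t. exp (- (a * t\<^sup>2 / 2)) * t ^ (2 * k))
    (sqrt (2 * pi / a) * (fact (2 * k) / ((2 * a) ^ k * fact k)))"
    and "has_bochner_integral lborel (\<lambda>t. exp (- (a * t\<^sup>2 / 2)) * t ^ (2 * k + 1)) 0"
    and "has_bochner_integral lborel (\<lambda>t. exp (- (a * t\<^sup>2 / 2)) * \<bar>t\<bar> ^ (2 * k + 1)) (2 * (2 ^ k * fact k / a ^ (k + 1)))"
proof -
  let ?s = "1 / sqrt a"
  have s: "0 < ?s" "?s\<^sup>2 = 1 / a" using a by (auto simp: power_divide)
  have eq: "exp (- (a * t\<^sup>2 / 2)) = sqrt (2 * pi / a) * normal_density 0 ?s t" for t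
    using a s by (simp add: normal_density_def real_sqrt_mult real_sqrt_divide)
  show "has_bochner_integral lborel (\<lambda>t. exp (- (a * t\<^sup>2 / 2)) * t ^ (2 * k))
    (sqrt (2 * pi / a) * (fact (2 * k) / ((2 * a) ^ k * fact k)))"
    using has_bochner_integral_mult_right[OF normal_moment_even[OF s(1), of 0 k], where c = "sqrt (2 * pi / a)"]
    unfolding eq s(2) by (simp add: mult.assoc)
  show "has_bochner_integral lborel (\<lambda>t. exp (- (a * t\<^sup>2 / 2)) * t ^ (2 * k + 1)) 0"
    using has_bochner_integral_mult_right[OF normal_moment_odd[OF s(1), of 0 k], where c = "sqrt (2 * pi / a)"]
    unfolding eq by (simp add: mult.assoc)
  have val: "sqrt (2 * pi / a) * (2 ^ k * ?s ^ (2 * k + 1) * fact k * sqrt (2 / pi)) = 2 * (2 ^ k * fact k / a ^ (k + 1))"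
  proof -
    have prod: "sqrt (2 * pi / a) * sqrt (2 / pi) * ?s = 2 / a"
    proof -
      have "sqrt (2 * pi / a) * sqrt (2 / pi) = sqrt (4 / a)"
        unfolding real_sqrt_mult[symmetric] by (simp add: field_simps)
      then show ?thesis using a by (simp add: real_sqrt_divide)
    qed
    have "?s ^ (2 * k + 1) = (1 / a) ^ k * ?s"
      by (simp only: power_add power_mult s(2) power_one_right)
    then have "sqrt (2 * pi / a) * (2 ^ k * ?s ^ (2 * k + 1) * fact k * sqrt (2 / pi))
        = 2 ^ k * fact k * (1 / a) ^ k * (sqrt (2 * pi / a) * sqrt (2 / pi) * ?s)"
      by (simp only: ac_simps)
    also have "\<dots> = 2 * (2 ^ k * fact k / a ^ (k + 1))"
      unfolding prod by (simp add: power_divide mult.commute)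
    finally show ?thesis .
  qed
  show "has_bochner_integral lborel (\<lambda>t. exp (- (a * t\<^sup>2 / 2)) * \<bar>t\<bar> ^ (2 * k + 1)) (2 * (2 ^ k * fact k / a ^ (k + 1)))"
    using has_bochner_integral_mult_right[OF normal_moment_abs_odd[OF s(1), of 0 k], where c = "sqrt (2 * pi / a)"]
    unfolding eq val by (simp add: mult.assoc)
qed

lemma exponential_tail_moment:
  fixes b u :: real
  assumes b: "0 < b"
  shows "has_bochner_integral lborel (\<lambda>x. indicator {u..} x * (exp (- (b * x)) * (x - u) ^ k))
    (exp (- (b * u)) * fact k / b ^ Suc k)"
proof -
  have "has_bochner_integral lborel (\<lambda>y. exp (- (b * u)) / b ^ k * (indicator {0..} y * (y ^ k * exp (- y)))) (exp (- (b * u)) / b ^ k * fact k)"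
  proof (rule has_bochner_integral_mult_right)
    show "has_bochner_integral lborel (\<lambda>y::real. indicator {0..} y * (y ^ k * exp (- y))) (fact k)"
      using has_bochner_integral_I0i_power_exp_m'[of k] by (simp add: ac_simps)
  qed
  moreover have "exp (- (b * u)) / b ^ k * (indicator {0..} y * (y ^ k * exp (- y)))
     = indicator {u..} (u + 1 / b * y) * (exp (- (b * (u + 1 / b * y))) * (u + 1 / b * y - u) ^ k)" for y
  proof -
    have "b * (u + 1 / b * y) = b * u + y"
      using b by (simp add: field_simps)
    moreover have "indicator {u..} (u + 1 / b * y) = (indicator {0..} y :: real)"
      using b by (auto simp: field_simps split: split_indicator)
    ultimately show ?thesis
      by (simp add: power_divide exp_diff exp_minus field_simps)
  qed
  ultimately have "has_bochner_integral lborel (\<lambda>y. indicator {u..} (u + 1 / b * y) * (exp (- (b * (u + 1 / b * y))) * (u + 1 / b * y - u) ^ k))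
     (exp (- (b * u)) / b ^ k * fact k)"
    by simp
  then show ?thesis
    using b by (subst lborel_has_bochner_integral_real_affine_iff[where c = "1 / b" and t = u]) (auto simp: field_simps)
qed

section \<open>The integrand near the saddle point\<close>

lemma iexp_cubic_approx:
  fixes y :: real
  shows "norm (exp (\<i> * complex_of_real y) - (1 + \<i> * complex_of_real y - complex_of_real (y\<^sup>2 / 2)
     - \<i> * complex_of_real (y ^ 3 / 6))) \<le> y ^ 4 / 24"
proof -
  have "(\<Sum>k\<le>3. (\<i> * complex_of_real y) ^ k / fact k)
      = 1 + \<i> * complex_of_real y - complex_of_real (y\<^sup>2 / 2) - \<i> * complex_of_real (y ^ 3 / 6)"
    by (simp add: numeral_3_eq_3 power_mult_distrib fact_numeral power2_eq_square)
  moreover have "\<bar>y\<bar> ^ Suc 3 / fact (Suc 3) = y ^ 4 / 24"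
    by (simp add: fact_numeral)
  ultimately show ?thesis
    using iexp_approx1[of y 3] by (simp only:)
qed

context levy_intensity
begin

lemma transform_Taylor:
  "norm (transform b t - (complex_of_real (mom 0 b) + \<i> * complex_of_real (t * mom 1 b)
     - complex_of_real (t\<^sup>2 / 2 * mom 2 b) - \<i> * complex_of_real (t ^ 3 / 6 * mom 3 b))) \<le> t ^ 4 / 24 * mom 4 b"
proof -
  let ?m = "\<lambda>k x. w x * x ^ k * exp (b * x)"
  let ?p = "\<lambda>x. complex_of_real (?m 0 x) + \<i> * complex_of_real (t * ?m 1 x)
     - complex_of_real (t\<^sup>2 / 2 * ?m 2 x) - \<i> * complex_of_real (t ^ 3 / 6 * ?m 3 x)"
  let ?e = "\<lambda>x. complex_of_real (w x * exp (b * x)) * exp (\<i> * complex_of_real (t * x))"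
  have e_int: "integrable lborel ?e"
    by (rule Bochner_Integration.integrable_bound[OF mom_integrable[of 0 b]]) (auto simp: norm_mult)
  have m_int: "has_bochner_integral lborel (\<lambda>x. complex_of_real (c * ?m k x)) (complex_of_real (c * mom k b))" for c k
    unfolding mom_def
    by (rule has_bochner_integral_of_real, rule has_bochner_integral_mult_right,
        rule has_bochner_integral_integrable, rule mom_integrable)
  have im_int: "has_bochner_integral lborel (\<lambda>x. \<i> * complex_of_real (c * ?m k x)) (\<i> * complex_of_real (c * mom k b))" for c k
    by (rule has_bochner_integral_mult_right, rule m_int)
  have m0_int: "has_bochner_integral lborel (\<lambda>x. complex_of_real (?m 0 x)) (complex_of_real (mom 0 b))"
    using m_int[of 1 0] by simp
  note p_int = has_bochner_integral_diff[OF has_bochner_integral_diff[OF has_bochner_integral_add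
     [OF m0_int im_int[of t 1]] m_int[of "t\<^sup>2 / 2" 2]] im_int[of "t ^ 3 / 6" 3]]
  have diff: "transform b t - (complex_of_real (mom 0 b) + \<i> * complex_of_real (t * mom 1 b)
     - complex_of_real (t\<^sup>2 / 2 * mom 2 b) - \<i> * complex_of_real (t ^ 3 / 6 * mom 3 b))
     = (\<integral>x. ?e x - ?p x \<partial>lborel)"
    unfolding transform_alt has_bochner_integral_integral_eq[OF p_int, symmetric]
    by (rule Bochner_Integration.integral_diff[OF e_int integrable.intros[OF p_int], symmetric])
  have "norm (\<integral>x. ?e x - ?p x \<partial>lborel) \<le> (\<integral>x. t ^ 4 / 24 * ?m 4 x \<partial>lborel)"
  proof (rule norm_integral_le)
    fix x
    let ?T = "1 + \<i> * complex_of_real (t * x) - complex_of_real ((t * x)\<^sup>2 / 2)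
     - \<i> * complex_of_real ((t * x) ^ 3 / 6)"
    have p: "?m 0 x = w x * exp (b * x)" "t * ?m 1 x = (w x * exp (b * x)) * (t * x)"
      "t\<^sup>2 / 2 * ?m 2 x = (w x * exp (b * x)) * ((t * x)\<^sup>2 / 2)"
      "t ^ 3 / 6 * ?m 3 x = (w x * exp (b * x)) * ((t * x) ^ 3 / 6)"
      by (simp_all add: power_mult_distrib)
    have "?p x = complex_of_real (w x * exp (b * x)) * ?T"
      unfolding p
      by (simp only: of_real_mult[of "w x * exp (b * x)"] distrib_left right_diff_distrib mult_1_right mult.left_commute[of \<i>])
    then have "?e x - ?p x = complex_of_real (w x * exp (b * x)) * (exp (\<i> * complex_of_real (t * x)) - ?T)"
      by (simp only: right_diff_distrib)
    then have "norm (?e x - ?p x) = w x * exp (b * x) * norm (exp (\<i> * complex_of_real (t * x)) - ?T)"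
      using w_nonneg[of x] by (simp only: norm_mult norm_of_real abs_mult abs_exp_cancel abs_of_nonneg)
    also have "\<dots> \<le> w x * exp (b * x) * ((t * x) ^ 4 / 24)"
      using w_nonneg by (intro mult_left_mono iexp_cubic_approx) auto
    also have "\<dots> = t ^ 4 / 24 * ?m 4 x"
      by (simp add: power_mult_distrib)
    finally show "norm (?e x - ?p x) \<le> t ^ 4 / 24 * ?m 4 x" .
  qed (rule integrable_mult_right, rule mom_integrable)
  also have "\<dots> = t ^ 4 / 24 * mom 4 b"
    using integral_mult_right_zero[of lborel "t ^ 4 / 24" "?m 4"] by (simp only: mom_def)
  finally show ?thesis
    unfolding diff .
qed

text \<open>The integrand of the inversion formula at \<open>x = mom 1 b\<close>, divided by the value \<open>exp (mom 0 b)\<close> that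
  the exponential of the transform has at \<open>t = 0\<close>. In terms
  of probability: up to negligible terms, the characteristic function of \<open>T - u\<close> under
  the tilted law.\<close>

definition centred :: "real \<Rightarrow> real \<Rightarrow> complex" where
  "centred b t = complex_of_real (exp (- mom 0 b)) * residual b t * exp (- (\<i> * complex_of_real (t * mom 1 b)))"

text \<open>The first-order Edgeworth approximation: the Gaussian given by the variance, corrected by the
  third cumulant.\<close>

definition edgeworth :: "real \<Rightarrow> real \<Rightarrow> complex" where
  "edgeworth b t = complex_of_real (exp (- (mom 2 b * t\<^sup>2 / 2))) * (1 - \<i> * complex_of_real (t ^ 3 / 6 * mom 3 b))"

text \<open>The exponent is \<open>- \<kappa> 2 * t\<^sup>2 / 2 + c + r\<close> with \<open>c\<close> the cubic term and \<open>r\<close> of fourth order. On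
  \<open>\<bar>t\<bar> \<le> 1/4\<close> the sum \<open>c + r\<close> is at most half of the quadratic term in absolute value, thanks to
  \<open>\<kappa> 2 \<ge> u / 4\<close>; so expanding \<open>exp (c + r)\<close> to first order still leaves half of the Gaussian decay.\<close>

lemma centred_local:
  assumes t: "\<bar>t\<bar> \<le> 1 / 4" and var: "mom 1 b \<le> 4 * mom 2 b"
  shows "norm (centred b t - edgeworth b t)
    \<le> exp (- (mom 2 b * t\<^sup>2 / 4)) * ((mom 1 b)\<^sup>2 * t ^ 6 + mom 1 b * t ^ 4) + exp (- mom 0 b) * (1 + mom 0 b)"
proof -
  let ?u = "mom 1 b" and ?v = "mom 2 b"
  have m3: "mom 3 b \<le> ?u" and m4: "mom 4 b \<le> ?u"
    using mom_le_mom_1[of 2 b] mom_le_mom_1[of 3 b] by auto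
  define c where "c = - (\<i> * complex_of_real (t ^ 3 / 6 * mom 3 b))"
  define r where "r = transform b t - (complex_of_real (mom 0 b) + \<i> * complex_of_real (t * mom 1 b)
     - complex_of_real (t\<^sup>2 / 2 * mom 2 b) - \<i> * complex_of_real (t ^ 3 / 6 * mom 3 b))"
  have u0: "0 \<le> ?u" by (rule mom_nonneg)
  have t4: "t ^ 4 = \<bar>t\<bar> ^ 3 * \<bar>t\<bar>"
    by (simp add: numeral_eq_Suc abs_mult_self_eq)
  have r_le: "norm r \<le> t ^ 4 / 24 * ?u"
    unfolding r_def by (rule order_trans[OF transform_Taylor mult_left_mono[OF m4]]) simp
  have c_le: "norm c \<le> \<bar>t\<bar> ^ 3 / 6 * ?u"
    using m3 mom_nonneg[of 3 b] by (auto simp: c_def norm_mult norm_power intro!: mult_left_mono)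
  \<comment> \<open>\<open>1/6\<close> from the cubic term and \<open>1/24 * 1/4\<close> from the quartic one add up to \<open>17/96\<close>.\<close>
  have "t ^ 4 \<le> \<bar>t\<bar> ^ 3 * (1 / 4)"
    unfolding t4 by (intro mult_left_mono t) auto
  then have "t ^ 4 / 24 * ?u \<le> \<bar>t\<bar> ^ 3 / 96 * ?u"
    by (intro mult_right_mono u0) simp
  with r_le c_le norm_triangle_ineq[of c r]
  have cr_le: "norm (c + r) \<le> 17 / 96 * (\<bar>t\<bar> ^ 3 * ?u)"
    by (simp add: algebra_simps)
  have q0: "0 \<le> \<bar>t\<bar> ^ 3 * ?u"
    using u0 by simp
  have cr_sq: "(norm (c + r))\<^sup>2 \<le> ?u\<^sup>2 * t ^ 6"
  proof -
    have "norm (c + r) \<le> \<bar>t\<bar> ^ 3 * ?u"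
      using cr_le q0 by linarith
    then have "(norm (c + r))\<^sup>2 \<le> (\<bar>t\<bar> ^ 3 * ?u)\<^sup>2"
      by (intro power_mono) auto
    moreover have "(\<bar>t\<bar> ^ 3)\<^sup>2 = t ^ 6"
      by (simp only: power_abs[symmetric] power2_abs power_mult[symmetric]) simp
    ultimately show ?thesis
      by (simp add: power_mult_distrib mult.commute)
  qed
  have cr_gauss: "norm (c + r) \<le> ?v * t\<^sup>2 / 4"
  proof -
    have "\<bar>t\<bar> ^ 3 * ?u = t\<^sup>2 * (\<bar>t\<bar> * ?u)"
      by (simp add: power3_eq_cube power2_eq_square)
    also have "\<dots> \<le> t\<^sup>2 * (1 / 4 * (4 * ?v))"
      using t var u0 by (intro mult_left_mono mult_mono) auto
    also have "\<dots> = ?v * t\<^sup>2"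
      by simp
    finally have "\<bar>t\<bar> ^ 3 * ?u \<le> ?v * t\<^sup>2" .
    then show ?thesis
      using cr_le q0 by linarith
  qed
  let ?g = "exp (- (?v * t\<^sup>2 / 2))"
  have centred_eq: "centred b t = complex_of_real ?g * exp (c + r)
      - complex_of_real (exp (- mom 0 b)) * (1 + transform b t) * exp (- (\<i> * complex_of_real (t * ?u)))"
  proof -
    have "complex_of_real (exp (- mom 0 b)) * exp (transform b t) * exp (- (\<i> * complex_of_real (t * ?u)))
       = complex_of_real ?g * exp (c + r)"
      unfolding exp_of_real[symmetric] exp_add[symmetric]
      by (rule arg_cong[where f = exp]) (simp add: c_def r_def algebra_simps)
    then show ?thesis
      unfolding centred_def residual_def by (simp add: algebra_simps)
  qed
  have "centred b t - edgeworth b t = complex_of_real ?g * ((exp (c + r) - 1 - (c + r)) + r)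
      - complex_of_real (exp (- mom 0 b)) * (1 + transform b t) * exp (- (\<i> * complex_of_real (t * ?u)))"
    unfolding centred_eq edgeworth_def c_def by (simp add: algebra_simps)
  also have "norm \<dots> \<le> ?g * norm ((exp (c + r) - 1 - (c + r)) + r) + exp (- mom 0 b) * norm (1 + transform b t)"
    by (rule order_trans[OF norm_triangle_ineq4]) (simp add: norm_mult)
  also have "\<dots> \<le> ?g * (exp (?v * t\<^sup>2 / 4) * (?u\<^sup>2 * t ^ 6 + ?u * t ^ 4)) + exp (- mom 0 b) * (1 + mom 0 b)"
  proof (intro add_mono mult_left_mono)
    show "norm (1 + transform b t) \<le> 1 + mom 0 b"
      using norm_triangle_ineq[of 1 "transform b t"] norm_transform_le[of b t] by simp
    have "norm (exp (c + r) - 1 - (c + r)) \<le> exp \<bar>Re (c + r)\<bar> * (norm (c + r))\<^sup>2"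
      by (rule norm_exp_remainder)
    also have "\<dots> \<le> exp (?v * t\<^sup>2 / 4) * (?u\<^sup>2 * t ^ 6)"
      using abs_Re_le_cmod[of "c + r"] cr_gauss by (intro mult_mono cr_sq) auto
    finally have 1: "norm (exp (c + r) - 1 - (c + r)) \<le> exp (?v * t\<^sup>2 / 4) * (?u\<^sup>2 * t ^ 6)" .
    have "0 \<le> t ^ 4 * ?u"
      using u0 by simp
    then have "norm r \<le> 1 * (?u * t ^ 4)"
      using r_le by (simp add: mult.commute)
    also have "\<dots> \<le> exp (?v * t\<^sup>2 / 4) * (?u * t ^ 4)"
      using u0 mom_nonneg[of 2 b] by (intro mult_right_mono) auto
    finally show "norm ((exp (c + r) - 1 - (c + r)) + r) \<le> exp (?v * t\<^sup>2 / 4) * (?u\<^sup>2 * t ^ 6 + ?u * t ^ 4)"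
      using 1 norm_triangle_ineq[of "exp (c + r) - 1 - (c + r)" r] by (simp add: distrib_left)
  qed auto
  also have "?g * (exp (?v * t\<^sup>2 / 4) * (?u\<^sup>2 * t ^ 6 + ?u * t ^ 4)) = exp (- (?v * t\<^sup>2 / 4)) * (?u\<^sup>2 * t ^ 6 + ?u * t ^ 4)"
  proof -
    have "?g * exp (?v * t\<^sup>2 / 4) = exp (- (?v * t\<^sup>2 / 4))"
      by (simp flip: exp_add)
    then show ?thesis
      by (simp only: mult.assoc[symmetric])
  qed
  finally show ?thesis .
qed

section \<open>Decay away from the saddle point\<close>

text \<open>Cancellation in the transform that is guaranteed once \<open>\<bar>t\<bar> \<ge> 1/4\<close> by the part \<open>\<epsilon>\<close> of the intensity on
  \<open>{1 - \<epsilon>..1}\<close>: the integral of \<open>\<epsilon> * exp (b * x)\<close> over this interval minus a bound for the modulus of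
  the integral of \<open>\<epsilon> * exp ((b + \<i> * t) * x)\<close>. It is of order \<open>exp b / b ^ 3\<close>.\<close>

definition rho :: "real \<Rightarrow> real" where
  "rho b = \<epsilon> * ((exp b - exp (b * (1 - \<epsilon>))) / b - (exp b + exp (b * (1 - \<epsilon>))) / sqrt (b\<^sup>2 + 1 / 16))"

lemma exp_integral_top:
  assumes b: "0 < b"
  shows "has_bochner_integral lborel (\<lambda>x. indicator {1 - \<epsilon>..1} x *\<^sub>R exp (Complex b t * complex_of_real x))
     (exp (Complex b t) / Complex b t - exp (Complex b t * (1 - \<epsilon>)) / Complex b t)"
    and "has_bochner_integral lborel (\<lambda>x. indicator {1 - \<epsilon>..1} x *\<^sub>R exp (b * x))
     ((exp b - exp (b * (1 - \<epsilon>))) / b)"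
proof -
  let ?z = "Complex b t"
  have z: "?z \<noteq> 0" using b by (simp add: complex_eq_iff)
  have "has_bochner_integral lborel (\<lambda>x. indicator {1 - \<epsilon>..1} x *\<^sub>R exp (?z * complex_of_real x))
     ((\<lambda>x. exp (?z * complex_of_real x) / ?z) 1 - (\<lambda>x. exp (?z * complex_of_real x) / ?z) (1 - \<epsilon>))"
  proof (rule has_bochner_integral_FTC_Icc)
    show "1 - \<epsilon> \<le> 1" using \<epsilon>_pos by simp
    show "((\<lambda>x. exp (?z * complex_of_real x) / ?z) has_vector_derivative exp (?z * complex_of_real x)) (at x within {1 - \<epsilon>..1})" for x
    proof (rule has_vector_derivative_real_field)
      show "((\<lambda>y. exp (?z * y) / ?z) has_field_derivative exp (?z * complex_of_real x)) (at (complex_of_real x))"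
        using z by (auto intro!: derivative_eq_intros)
    qed
    show "continuous_on {1 - \<epsilon>..1} (\<lambda>x. exp (?z * complex_of_real x))"
      by (intro continuous_intros)
  qed
  then show "has_bochner_integral lborel (\<lambda>x. indicator {1 - \<epsilon>..1} x *\<^sub>R exp (?z * complex_of_real x))
     (exp ?z / ?z - exp (?z * (1 - \<epsilon>)) / ?z)"
    by simp
  have "has_bochner_integral lborel (\<lambda>x. indicator {1 - \<epsilon>..1} x *\<^sub>R exp (b * x))
     ((\<lambda>x. exp (b * x) / b) 1 - (\<lambda>x. exp (b * x) / b) (1 - \<epsilon>))"
  proof (rule has_bochner_integral_FTC_Icc)
    show "1 - \<epsilon> \<le> 1" using \<epsilon>_pos by simp
    show "((\<lambda>x. exp (b * x) / b) has_vector_derivative exp (b * x)) (at x within {1 - \<epsilon>..1})" for x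
      using b unfolding has_real_derivative_iff_has_vector_derivative[symmetric]
      by (auto intro!: derivative_eq_intros)
    show "continuous_on {1 - \<epsilon>..1} (\<lambda>x. exp (b * x))"
      by (intro continuous_intros)
  qed
  then show "has_bochner_integral lborel (\<lambda>x. indicator {1 - \<epsilon>..1} x *\<^sub>R exp (b * x))
     ((exp b - exp (b * (1 - \<epsilon>))) / b)"
    by (simp add: diff_divide_distrib)
qed

text \<open>Split the intensity into \<open>\<epsilon>\<close> times the indicator of \<open>{1 - \<epsilon>..1}\<close> and a nonnegative rest. The rest
  is bounded trivially by its mass, the first part by explicit integration. Bounding the modulus
  itself, and not only the real part, makes the estimate usable for \<open>exp H - 1 - H\<close>.\<close>

lemma norm_transform_le_rho:
  assumes b: "0 < b" and t: "1 / 4 \<le> \<bar>t\<bar>"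
  shows "norm (transform b t) \<le> mom 0 b - rho b"
proof -
  let ?z = "Complex b t" and ?S = "{1 - \<epsilon>..1}"
  let ?I = "exp ?z / ?z - exp (?z * (1 - \<epsilon>)) / ?z"
  let ?r = "\<lambda>x. w x - \<epsilon> * indicator ?S x"
  let ?e = "\<lambda>x. exp (?z * complex_of_real x)"
  note top = exp_integral_top[OF b]
  have r_nonneg: "0 \<le> ?r x" for x
    using w_lower[of x] w_nonneg[of x] by (auto split: split_indicator)
  have w_int: "integrable lborel (\<lambda>x. complex_of_real (w x) * ?e x)"
    by (rule integrable_cmgf) (use mom_integrable[of 0] in auto)
  have top_int: "has_bochner_integral lborel (\<lambda>x. complex_of_real (\<epsilon> * indicator ?S x) * ?e x) (complex_of_real \<epsilon> * ?I)"
    using has_bochner_integral_mult_right[OF top(1), where c = "complex_of_real \<epsilon>"]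
    by (simp add: scaleR_conv_of_real mult.assoc)
  have "transform b t = (\<integral>x. complex_of_real (?r x) * ?e x \<partial>lborel) + complex_of_real \<epsilon> * ?I"
  proof -
    have "transform b t = (\<integral>x. (complex_of_real (w x) * ?e x - complex_of_real (\<epsilon> * indicator ?S x) * ?e x)
        + complex_of_real (\<epsilon> * indicator ?S x) * ?e x \<partial>lborel)"
      unfolding transform_def cmgf_def by simp
    also have "\<dots> = (\<integral>x. complex_of_real (w x) * ?e x - complex_of_real (\<epsilon> * indicator ?S x) * ?e x \<partial>lborel) + complex_of_real \<epsilon> * ?I"
      using w_int top_int by (subst Bochner_Integration.integral_add) (auto simp: has_bochner_integral_iff)
    finally show ?thesis by (simp only: of_real_diff left_diff_distrib)
  qed
  then have "norm (transform b t) \<le> norm (\<integral>x. complex_of_real (?r x) * ?e x \<partial>lborel) + norm (complex_of_real \<epsilon> * ?I)"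
    by (simp only: norm_triangle_ineq)
  also have "norm (complex_of_real \<epsilon> * ?I) = \<epsilon> * norm ?I"
    by (simp only: norm_mult norm_of_real abs_of_pos[OF \<epsilon>_pos])
  also have "norm (\<integral>x. complex_of_real (?r x) * ?e x \<partial>lborel) \<le> mom 0 b - \<epsilon> * ((exp b - exp (b * (1 - \<epsilon>))) / b)"
  proof -
    have val: "has_bochner_integral lborel (\<lambda>x. ?r x * exp (b * x)) (mom 0 b - \<epsilon> * ((exp b - exp (b * (1 - \<epsilon>))) / b))"
    proof -
      have "has_bochner_integral lborel (\<lambda>x. w x * x ^ 0 * exp (b * x) - \<epsilon> * (indicator ?S x *\<^sub>R exp (b * x)))
         (mom 0 b - \<epsilon> * ((exp b - exp (b * (1 - \<epsilon>))) / b))"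
        unfolding mom_def
        by (intro has_bochner_integral_diff has_bochner_integral_mult_right top(2)
            has_bochner_integral_integrable mom_integrable)
      then show ?thesis by (simp add: left_diff_distrib mult.assoc)
    qed
    have "norm (\<integral>x. complex_of_real (?r x) * ?e x \<partial>lborel) \<le> (\<integral>x. ?r x * exp (b * x) \<partial>lborel)"
    proof (rule norm_integral_le)
      show "integrable lborel (\<lambda>x. ?r x * exp (b * x))"
        using val by (simp add: has_bochner_integral_iff)
      show "norm (complex_of_real (?r x) * ?e x) \<le> ?r x * exp (b * x)" for x
        unfolding norm_mult norm_of_real abs_of_nonneg[OF r_nonneg] by simp
    qed
    then show ?thesis using val by (simp add: has_bochner_integral_iff)
  qed
  also have "\<epsilon> * norm ?I \<le> \<epsilon> * ((exp b + exp (b * (1 - \<epsilon>))) / sqrt (b\<^sup>2 + 1 / 16))"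
  proof (rule mult_left_mono)
    have t2: "1 / 16 \<le> t\<^sup>2"
      using power_mono[OF t, of 2] by (simp add: power2_eq_square)
    have "norm ?I = norm (exp ?z - exp (?z * (1 - \<epsilon>))) / norm ?z"
      by (simp add: norm_divide flip: diff_divide_distrib)
    also have "\<dots> \<le> (norm (exp ?z) + norm (exp (?z * (1 - \<epsilon>)))) / norm ?z"
      by (intro divide_right_mono norm_triangle_ineq4) auto
    also have "\<dots> = (exp b + exp (b * (1 - \<epsilon>))) / sqrt (b\<^sup>2 + t\<^sup>2)"
      by (simp add: complex_norm)
    also have "\<dots> \<le> (exp b + exp (b * (1 - \<epsilon>))) / sqrt (b\<^sup>2 + 1 / 16)"
      using t2 by (intro divide_left_mono mult_pos_pos add_nonneg_nonneg) (use b in \<open>auto intro!: add_nonneg_pos add_pos_nonneg\<close>)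
    finally show "norm ?I \<le> (exp b + exp (b * (1 - \<epsilon>))) / sqrt (b\<^sup>2 + 1 / 16)" .
  qed (use \<epsilon>_pos in simp)
  finally show ?thesis
    unfolding rho_def by (simp add: right_diff_distrib)
qed

text \<open>With \<open>s = exp (- \<epsilon> * b)\<close>, which is smaller than any power of \<open>1 / b\<close>, the definition of \<open>rho\<close> reads
  \<open>\<epsilon> * exp b * ((1 - s) / b - (1 + s) / sqrt (b\<^sup>2 + 1 / 16))\<close>, and
  \<open>1 / b - 1 / sqrt (b\<^sup>2 + 1 / 16)\<close> is of order \<open>1 / b ^ 3\<close>.\<close>

lemma rho_large: "\<forall>\<^sub>F b in at_top. exp (- rho b) * exp (4 * b) \<le> 1"
proof -
  have s_small: "\<forall>\<^sub>F b in at_top. b ^ 3 * exp (- (\<epsilon> * b)) < 1 / 100"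
  proof (rule order_tendstoD)
    show "((\<lambda>b. b ^ 3 * exp (- (\<epsilon> * b))) \<longlongrightarrow> 0) at_top"
      using \<epsilon>_pos by real_asymp
  qed simp
  have main: "\<forall>\<^sub>F b :: real in at_top. b\<^sup>2 \<le> exp b * (1 / b - 1 / sqrt (b\<^sup>2 + 1 / 16) - 2 / (100 * b ^ 4))"
    by real_asymp
  from s_small main eventually_gt_at_top[of 0] eventually_ge_at_top[of "4 / \<epsilon>"] show ?thesis
  proof eventually_elim
    case (elim b)
    let ?s = "exp (- (\<epsilon> * b))" and ?q = "sqrt (b\<^sup>2 + 1 / 16)"
    have q: "b \<le> ?q" "0 < ?q"
      using elim by (auto intro!: real_le_rsqrt add_nonneg_pos)
    have s: "?s \<le> 1 / (100 * b ^ 3)"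
      using elim by (simp add: field_simps)
    have exp_split: "exp (b * (1 - \<epsilon>)) = exp b * ?s"
      by (simp add: right_diff_distrib exp_diff exp_minus mult.commute divide_inverse)
    have "exp b * (1 / b - 1 / ?q - 2 / (100 * b ^ 4)) \<le> exp b * (1 / b - 1 / ?q - ?s / b - ?s / ?q)"
    proof (intro mult_left_mono)
      have arith: "x \<le> y \<Longrightarrow> y \<le> z \<Longrightarrow> z = v / 2 \<Longrightarrow> p - q - v \<le> p - q - y - x" for x y z v p q :: real
        by linarith
      have s1: "?s / ?q \<le> ?s / b"
        using q elim by (intro divide_left_mono) auto
      have s2: "?s / b \<le> 1 / (100 * b ^ 3) / b"
        using s elim by (intro divide_right_mono) auto
      have s3: "1 / (100 * b ^ 3) / b = 2 / (100 * b ^ 4) / 2"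
        by (simp add: eval_nat_numeral)
      show "1 / b - 1 / ?q - 2 / (100 * b ^ 4) \<le> 1 / b - 1 / ?q - ?s / b - ?s / ?q"
        by (rule arith[OF s1 s2 s3])
    qed simp
    also have "\<dots> = (exp b - exp b * ?s) / b - (exp b + exp b * ?s) / ?q"
      by (simp add: right_diff_distrib diff_divide_distrib add_divide_distrib)
    finally have "\<epsilon> * b\<^sup>2 \<le> rho b"
      unfolding rho_def exp_split using elim \<epsilon>_pos by (intro mult_left_mono) auto
    moreover have "4 * b \<le> (\<epsilon> * b) * b"
      using elim \<epsilon>_pos by (intro mult_right_mono) (auto simp: field_simps)
    ultimately have "4 * b \<le> rho b"
      by (simp add: power2_eq_square mult.assoc)
    then show ?case by (simp flip: exp_add)
  qed
qed

text \<open>The function \<open>x - 4 * x\<^sup>2\<close> is positive only for \<open>x < 1/4\<close>, where the tilting factor is at most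
  \<open>exp (b / 4)\<close>, and it is at most \<open>- 1 / 2\<close> on \<open>{1 - \<epsilon>..1}\<close>, whose weight is at least of order \<open>exp b / b\<close>.\<close>

lemma mom_1_le_mom_2: "\<forall>\<^sub>F b in at_top. mom 1 b \<le> 4 * mom 2 b"
proof -
  have "\<forall>\<^sub>F b in at_top. B * exp (b / 4) - \<epsilon> / 2 * ((exp b - exp (b * (1 - \<epsilon>))) / b) \<le> 0"
  proof -
    have s_small: "\<forall>\<^sub>F b in at_top. exp (- (\<epsilon> * b)) < 1 / 2"
    proof (rule order_tendstoD)
      show "((\<lambda>b. exp (- (\<epsilon> * b))) \<longlongrightarrow> 0) at_top"
        using \<epsilon>_pos by real_asymp
    qed simp
    have small: "\<forall>\<^sub>F b :: real in at_top. b * exp (b / 4) / exp b < \<epsilon> / (4 * (B + 1))"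
    proof (rule order_tendstoD)
      show "((\<lambda>b :: real. b * exp (b / 4) / exp b) \<longlongrightarrow> 0) at_top"
        by real_asymp
    qed (use \<epsilon>_pos B_nonneg in auto)
    from s_small small eventually_gt_at_top[of 0] show ?thesis
    proof eventually_elim
      case (elim b)
      have "exp (b * (1 - \<epsilon>)) = exp b * exp (- (\<epsilon> * b))"
        by (simp add: right_diff_distrib exp_diff exp_minus mult.commute divide_inverse)
      also have "\<dots> \<le> exp b * (1 / 2)"
        using elim by (intro mult_left_mono) auto
      finally have "\<epsilon> / 2 * ((exp b - exp b * (1 / 2)) / b) \<le> \<epsilon> / 2 * ((exp b - exp (b * (1 - \<epsilon>))) / b)"
        using elim \<epsilon>_pos by (intro mult_left_mono divide_right_mono) auto
      moreover have "(B + 1) * exp (b / 4) \<le> \<epsilon> / 2 * ((exp b - exp b * (1 / 2)) / b)"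
      proof -
        have "b * exp (b / 4) \<le> \<epsilon> / (4 * (B + 1)) * exp b"
          using elim(2) by (simp add: divide_less_eq)
        then have "(B + 1) * (b * exp (b / 4)) \<le> (B + 1) * (\<epsilon> / (4 * (B + 1)) * exp b)"
          using B_nonneg by (intro mult_left_mono) auto
        also have "\<dots> = \<epsilon> / 4 * exp b"
          using B_nonneg by (simp add: field_simps)
        finally show ?thesis
          using elim by (simp add: field_simps)
      qed
      moreover have "B * exp (b / 4) \<le> (B + 1) * exp (b / 4)"
        by (simp add: distrib_right)
      ultimately show ?case by linarith
    qed
  qed
  with eventually_gt_at_top[of 0] show ?thesis
  proof eventually_elim
    case (elim b)
    let ?S = "{1 - \<epsilon>..1}"
    have dom: "has_bochner_integral lborel (\<lambda>x. B * exp (b / 4) * indicator {0..1} x - \<epsilon> / 2 * (indicator ?S x *\<^sub>R exp (b * x)))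
      (B * exp (b / 4) * measure lborel {0..1 :: real} - \<epsilon> / 2 * ((exp b - exp (b * (1 - \<epsilon>))) / b))"
      by (intro has_bochner_integral_diff has_bochner_integral_mult_right exp_integral_top(2) elim
         has_bochner_integral_real_indicator) auto
    have diff: "has_bochner_integral lborel (\<lambda>x. w x * x ^ 1 * exp (b * x) - 4 * (w x * x ^ 2 * exp (b * x))) (mom 1 b - 4 * mom 2 b)"
      unfolding mom_def
      by (intro has_bochner_integral_diff has_bochner_integral_mult_right
            has_bochner_integral_integrable mom_integrable)
    have "mom 1 b - 4 * mom 2 b = (\<integral>x. w x * x ^ 1 * exp (b * x) - 4 * (w x * x ^ 2 * exp (b * x)) \<partial>lborel)"
      using diff by (simp add: has_bochner_integral_iff)
    also have "\<dots> \<le> (\<integral>x. B * exp (b / 4) * indicator {0..1} x - \<epsilon> / 2 * (indicator ?S x *\<^sub>R exp (b * x)) \<partial>lborel)"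
    proof (rule integral_mono)
      fix x
      have eq: "w x * x ^ 1 * exp (b * x) - 4 * (w x * x ^ 2 * exp (b * x)) = w x * exp (b * x) * (x * (1 - 4 * x))"
        by (simp add: algebra_simps power2_eq_square)
      consider "x \<notin> {0..1}" | "0 \<le> x" "x < 1 / 4" | "1 / 4 \<le> x" "x < 1 - \<epsilon>" | "1 - \<epsilon> \<le> x" "x \<le> 1"
        by fastforce
      then show "w x * x ^ 1 * exp (b * x) - 4 * (w x * x ^ 2 * exp (b * x))
          \<le> B * exp (b / 4) * indicator {0..1} x - \<epsilon> / 2 * (indicator ?S x *\<^sub>R exp (b * x))"
      proof cases
        case 1
        then show ?thesis using \<epsilon>_le by (auto simp: w_support split: split_indicator)
      next
        case 2
        have "w x * exp (b * x) * (x * (1 - 4 * x)) \<le> B * exp (b / 4) * 1"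
          using 2 w_nonneg[of x] w_le[of x] elim by (intro mult_mono mult_le_one) (auto intro: mult_left_mono)
        then show ?thesis unfolding eq using 2 \<epsilon>_le by simp
      next
        case 3
        have "w x * exp (b * x) * (x * (1 - 4 * x)) \<le> 0"
          using 3 w_nonneg[of x] by (intro mult_nonneg_nonpos) auto
        moreover have "0 \<le> B * exp (b / 4) * indicator {0..1} x"
          using B_nonneg by simp
        ultimately show ?thesis unfolding eq using 3 by simp
      next
        case 4
        then have x: "1 / 2 \<le> x" using \<epsilon>_le by simp
        have "1 / 2 * 1 \<le> x * (4 * x - 1)"
          using x by (intro mult_mono) auto
        then have "\<epsilon> * exp (b * x) * (1 / 2) \<le> w x * exp (b * x) * (x * (4 * x - 1))"
          using w_lower[of x] 4 \<epsilon>_pos w_nonneg[of x] by (intro mult_mono mult_right_mono) auto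
        moreover have "0 \<le> B * exp (b / 4) * indicator {0..1} x"
          using B_nonneg by simp
        ultimately show ?thesis unfolding eq using 4 by (simp add: algebra_simps)
      qed
    qed (use dom diff in \<open>auto simp: has_bochner_integral_iff\<close>)
    also have "\<dots> \<le> 0"
      using dom elim by (simp add: has_bochner_integral_iff)
    finally show ?case by simp
  qed
qed

section \<open>The integral along the saddle line\<close>

lemma centred_tail:
  assumes b: "0 < b" and t: "1 / 4 \<le> \<bar>t\<bar>"
  shows "norm (centred b t) \<le> exp (- rho b) * (norm (transform b t))\<^sup>2"
proof -
  have "norm (centred b t) = exp (- mom 0 b) * norm (residual b t)"
    by (simp add: centred_def norm_mult)
  also have "\<dots> \<le> exp (- mom 0 b) * (exp (mom 0 b - rho b) * (norm (transform b t))\<^sup>2)"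
  proof (rule mult_left_mono)
    have "norm (residual b t) \<le> exp \<bar>Re (transform b t)\<bar> * (norm (transform b t))\<^sup>2"
      unfolding residual_def by (rule norm_exp_remainder)
    also have "\<dots> \<le> exp (mom 0 b - rho b) * (norm (transform b t))\<^sup>2"
      using norm_transform_le_rho[OF b t] abs_Re_le_cmod[of "transform b t"] by (intro mult_right_mono) auto
    finally show "norm (residual b t) \<le> exp (mom 0 b - rho b) * (norm (transform b t))\<^sup>2" .
  qed simp
  also have "\<dots> = exp (- mom 0 b + (mom 0 b - rho b)) * (norm (transform b t))\<^sup>2"
    by (simp only: exp_add mult.assoc)
  finally show ?thesis by simp
qed

lemma norm_edgeworth_le: "norm (edgeworth b t) \<le> exp (- (mom 2 b * t\<^sup>2 / 2)) * (1 + \<bar>t\<bar> ^ 3 * mom 1 b)"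
proof -
  have "norm (1 - \<i> * complex_of_real (t ^ 3 / 6 * mom 3 b)) \<le> 1 + \<bar>t\<bar> ^ 3 / 6 * mom 3 b"
    using norm_triangle_ineq4[of 1 "\<i> * complex_of_real (t ^ 3 / 6 * mom 3 b)"] mom_nonneg[of 3 b]
    by (simp add: norm_mult norm_power)
  also have "\<bar>t\<bar> ^ 3 / 6 * mom 3 b \<le> \<bar>t\<bar> ^ 3 * mom 1 b"
    using mom_le_mom_1[of 2 b] mom_nonneg[of 3 b]
    by (intro mult_mono) auto
  finally show ?thesis
    by (simp add: edgeworth_def norm_mult)
qed

text \<open>Outside \<open>\<bar>t\<bar> \<le> 1/4\<close> powers of \<open>t\<close> may be raised at the cost of powers of \<open>4\<close>, so the Gaussian tail
  takes the form of the fourth-order error term of \<open>centred_local\<close>; here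
  \<open>260 = 4 ^ 4 + 4\<close>.\<close>

lemma edgeworth_tail:
  assumes t: "1 / 4 \<le> \<bar>t\<bar>" and u: "1 \<le> mom 1 b"
  shows "norm (edgeworth b t) \<le> exp (- (mom 2 b * t\<^sup>2 / 4)) * (260 * mom 1 b * t ^ 4)"
proof -
  have t4: "t ^ 4 = \<bar>t\<bar> ^ 4" by simp
  have "(1 / 4) ^ 4 \<le> \<bar>t\<bar> ^ 4"
    by (intro power_mono t) auto
  moreover have "(1 / 4 :: real) ^ 4 = 1 / 256"
    by (simp add: power_divide)
  ultimately have "1 \<le> 256 * t ^ 4" by simp
  then have 1: "1 \<le> mom 1 b * (256 * t ^ 4)"
    using mult_mono[OF u, of 1 "256 * t ^ 4"] mom_nonneg[of 1 b] by simp
  have "\<bar>t\<bar> ^ 3 * 1 \<le> \<bar>t\<bar> ^ 3 * (4 * \<bar>t\<bar>)"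
    using t by (intro mult_left_mono) auto
  also have "\<dots> = 4 * t ^ 4"
    unfolding t4 by (simp add: numeral_eq_Suc)
  finally have 2: "\<bar>t\<bar> ^ 3 * mom 1 b \<le> 4 * t ^ 4 * mom 1 b"
    using u by (intro mult_right_mono) auto
  have "norm (edgeworth b t) \<le> exp (- (mom 2 b * t\<^sup>2 / 2)) * (1 + \<bar>t\<bar> ^ 3 * mom 1 b)"
    by (rule norm_edgeworth_le)
  also have "\<dots> \<le> exp (- (mom 2 b * t\<^sup>2 / 4)) * (260 * mom 1 b * t ^ 4)"
  proof (intro mult_mono)
    show "1 + \<bar>t\<bar> ^ 3 * mom 1 b \<le> 260 * mom 1 b * t ^ 4"
      using 1 2 by (simp add: algebra_simps)
    show "exp (- (mom 2 b * t\<^sup>2 / 2)) \<le> exp (- (mom 2 b * t\<^sup>2 / 4))"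
      using mom_nonneg[of 2 b] by (simp add: mult_nonneg_nonneg)
  qed (use u in auto)
  finally show ?thesis .
qed

lemma centred_integrable: "integrable lborel (centred b)"
proof (rule Bochner_Integration.integrable_bound[OF integrable_mult_right[OF residual_integrable]])
  show "AE t in lborel. norm (centred b t) \<le> norm (complex_of_real (exp (- mom 0 b)) * residual b t)"
    by (simp add: centred_def norm_mult)
qed (simp add: centred_def[abs_def])

text \<open>Sum of the error terms of both regions, as a function on the whole line: the two Gaussian terms come
  from the Taylor expansion and from the Edgeworth approximation far out, the third is the
  contribution of the subtracted \<open>1 + H\<close> near the saddle point, the last is the decay away from it.\<close>

definition err :: "real \<Rightarrow> real \<Rightarrow> real" where
  "err b t = (mom 1 b)\<^sup>2 * (exp (- (mom 2 b / 2 * t\<^sup>2 / 2)) * t ^ (2 * 3))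
     + 260 * mom 1 b * (exp (- (mom 2 b / 2 * t\<^sup>2 / 2)) * t ^ (2 * 2))
     + exp (- mom 0 b) * (1 + mom 0 b) * indicator {- 1..1} t + exp (- rho b) * (norm (transform b t))\<^sup>2"

lemma centred_edgeworth_le_err:
  assumes b: "0 < b" and var: "mom 1 b \<le> 4 * mom 2 b" and u: "1 \<le> mom 1 b"
  shows "norm (centred b t - edgeworth b t) \<le> err b t"
proof -
  let ?E = "exp (- (mom 2 b * t\<^sup>2 / 4))"
  have err_eq: "err b t = ?E * ((mom 1 b)\<^sup>2 * t ^ 6 + 260 * mom 1 b * t ^ 4)
     + exp (- mom 0 b) * (1 + mom 0 b) * indicator {- 1..1} t + exp (- rho b) * (norm (transform b t))\<^sup>2"
    by (simp add: err_def algebra_simps)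
  have pos: "0 \<le> exp (- mom 0 b) * (1 + mom 0 b) * indicator {- 1..1} t" "0 \<le> exp (- rho b) * (norm (transform b t))\<^sup>2"
    using mom_nonneg[of 0 b] by auto
  show ?thesis
  proof (cases "\<bar>t\<bar> \<le> 1 / 4")
    case True
    have mono: "?E * ((mom 1 b)\<^sup>2 * t ^ 6 + mom 1 b * t ^ 4) \<le> ?E * ((mom 1 b)\<^sup>2 * t ^ 6 + 260 * mom 1 b * t ^ 4)"
      using u by (intro mult_left_mono add_left_mono mult_right_mono) auto
    have ind: "indicator {- 1..1} t = (1 :: real)"
      by (intro indicator_simps(1)) (unfold atLeastAtMost_iff, use True in linarith)
    show ?thesis
      using centred_local[OF True var] pos(2) mono unfolding err_eq ind mult_1_right by linarith
  next
    case False
    then have t: "1 / 4 \<le> \<bar>t\<bar>" by simp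
    have "norm (centred b t - edgeworth b t) \<le> norm (centred b t) + norm (edgeworth b t)"
      by (rule norm_triangle_ineq4)
    also have "\<dots> \<le> exp (- rho b) * (norm (transform b t))\<^sup>2 + ?E * (260 * mom 1 b * t ^ 4)"
      by (intro add_mono centred_tail[OF b t] edgeworth_tail[OF t u])
    also have "?E * (260 * mom 1 b * t ^ 4) \<le> ?E * ((mom 1 b)\<^sup>2 * t ^ 6 + 260 * mom 1 b * t ^ 4)"
      by (intro mult_left_mono) auto
    finally show ?thesis
      using pos unfolding err_eq by simp
  qed
qed

text \<open>With \<open>mom 2 b \<ge> u / 4\<close> the Gaussian terms \<open>u\<^sup>2 * t ^ 6\<close> and \<open>u * t ^ 4\<close> both integrate to order
  \<open>u powr (- 3 / 2)\<close>. The third term is exponentially small in \<open>mom 0 b \<ge> u\<close>, and the last is controlled by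
  the Plancherel bound and \<open>u \<le> B * exp b\<close>.\<close>

lemma err_integral:
  assumes b: "0 < b" and var: "mom 1 b \<le> 4 * mom 2 b" and u: "1 \<le> mom 1 b"
    and rho: "exp (- rho b) * exp (4 * b) \<le> 1"
  shows "integrable lborel (err b)"
    and "integral\<^sup>L lborel (err b) \<le> (500000 + 2 * pi * B ^ 4) / (mom 1 b * sqrt (mom 1 b))"
proof -
  let ?u = "mom 1 b" and ?v = "mom 2 b"
  have v: "0 < ?v / 2" "?u / 4 \<le> ?v" using var u by auto
  note g3 = gaussian_moments(1)[OF v(1), of 3]
  note g2 = gaussian_moments(1)[OF v(1), of 2]
  let ?s = "sqrt (2 * pi / (?v / 2))"
  let ?X = "?u\<^sup>2 * (?s * (fact (2 * 3) / ((2 * (?v / 2)) ^ 3 * fact 3)))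
     + 260 * ?u * (?s * (fact (2 * 2) / ((2 * (?v / 2)) ^ 2 * fact 2)))
     + exp (- mom 0 b) * (1 + mom 0 b) * measure lborel {- 1..1 :: real}
     + exp (- rho b) * (\<integral>t. (norm (transform b t))\<^sup>2 \<partial>lborel)"
  have ind: "has_bochner_integral lborel (indicator {- 1..1 :: real}) (measure lborel {- 1..1 :: real})"
    by (rule has_bochner_integral_real_indicator) auto
  have hbi: "has_bochner_integral lborel (err b) ?X"
    unfolding err_def[abs_def]
    by (rule has_bochner_integral_add[OF has_bochner_integral_add[OF has_bochner_integral_add
        [OF has_bochner_integral_mult_right[OF g3, where c = "?u\<^sup>2"]
          has_bochner_integral_mult_right[OF g2, where c = "260 * ?u"]]
          has_bochner_integral_mult_right[OF ind, where c = "exp (- mom 0 b) * (1 + mom 0 b)"]]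
          has_bochner_integral_mult_right[OF has_bochner_integral_integrable[OF transform_sq_integrable], where c = "exp (- rho b)"]])
  then show "integrable lborel (err b)"
    by (simp add: has_bochner_integral_iff)
  have ru: "0 < sqrt ?u" "sqrt ?u * sqrt ?u = ?u" "sqrt ?u \<le> ?u"
    using u mult_left_mono[of 1 "sqrt ?u" "sqrt ?u"] by auto
  have s: "?s \<le> 8 / sqrt ?u"
  proof -
    have "2 * pi / (?v / 2) \<le> 64 / ?u"
    proof -
      have "2 * pi * ?u \<le> 8 * (4 * ?v)"
        using pi_less_4 var u by (intro mult_mono) auto
      then show ?thesis
        using v u by (simp add: field_simps)
    qed
    then have "?s \<le> sqrt (64 / ?u)" by simp
    also have "\<dots> = 8 / sqrt ?u" by (simp add: real_sqrt_divide)
    finally show ?thesis .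
  qed
  have s0: "0 \<le> ?s" using v by simp
  have A: "?u\<^sup>2 * (?s * (fact (2 * 3) / ((2 * (?v / 2)) ^ 3 * fact 3))) \<le> 61440 / (?u * sqrt ?u)"
  proof -
    have "(?u / 4) ^ 3 \<le> ?v ^ 3"
      using v u by (intro power_mono) auto
    then have "120 / ?v ^ 3 \<le> 120 / (?u / 4) ^ 3"
      using u v by (intro divide_left_mono) auto
    then have "?s * (120 / ?v ^ 3) \<le> 8 / sqrt ?u * (120 / (?u / 4) ^ 3)"
      using s s0 v ru by (intro mult_mono) auto
    then have "?u\<^sup>2 * (?s * (120 / ?v ^ 3)) \<le> ?u\<^sup>2 * (8 / sqrt ?u * (120 / (?u / 4) ^ 3))"
      by (rule mult_left_mono) simp
    also have "\<dots> = 61440 / (?u * sqrt ?u)"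
      using u by (simp add: power2_eq_square power3_eq_cube field_simps)
    finally show ?thesis by (simp add: fact_numeral)
  qed
  have Bt: "260 * ?u * (?s * (fact (2 * 2) / ((2 * (?v / 2)) ^ 2 * fact 2))) \<le> 399360 / (?u * sqrt ?u)"
  proof -
    have "(?u / 4) ^ 2 \<le> ?v ^ 2"
      using v u by (intro power_mono) auto
    then have "12 / ?v ^ 2 \<le> 12 / (?u / 4) ^ 2"
      using u v by (intro divide_left_mono) auto
    then have "?s * (12 / ?v ^ 2) \<le> 8 / sqrt ?u * (12 / (?u / 4) ^ 2)"
      using s s0 v ru by (intro mult_mono) auto
    then have "260 * ?u * (?s * (12 / ?v ^ 2)) \<le> 260 * ?u * (8 / sqrt ?u * (12 / (?u / 4) ^ 2))"
      using u by (intro mult_left_mono) auto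
    also have "\<dots> = 399360 / (?u * sqrt ?u)"
      using u by (simp add: power2_eq_square field_simps)
    finally show ?thesis by (simp add: fact_numeral)
  qed
  have C: "exp (- mom 0 b) * (1 + mom 0 b) * measure lborel {- 1..1 :: real} \<le> 108 / (?u * sqrt ?u)"
  proof -
    let ?m = "mom 0 b"
    have m: "?u \<le> ?m" using mom_Suc_le[of 0 b] by simp
    \<comment> \<open>Any bound \<open>m ^ 3 = O (exp m)\<close> will do; this one uses only \<open>y \<le> exp y\<close>.\<close>
    have "(?m / 3) ^ 3 \<le> exp (?m / 3) ^ 3"
    proof (rule power_mono)
      show "?m / 3 \<le> exp (?m / 3)"
        using exp_ge_add_one_self[of "?m / 3"] by linarith
    qed (use m u in simp)
    also have "\<dots> = exp ?m"
      using exp_of_nat_mult[of 3 "?m / 3"] by simp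
    finally have m3: "?m ^ 3 \<le> 27 * exp ?m"
      by (simp add: power_divide)
    have "?u * sqrt ?u * (1 + ?m) \<le> ?m * ?m * (2 * ?m)"
      using ru m u by (intro mult_mono) auto
    also have "\<dots> \<le> 54 * exp ?m"
      using m3 by (simp add: power3_eq_cube)
    finally have "exp (- ?m) * (1 + ?m) \<le> 54 / (?u * sqrt ?u)"
      using ru u by (simp add: field_simps exp_minus)
    then show ?thesis by simp
  qed
  have D: "exp (- rho b) * (\<integral>t. (norm (transform b t))\<^sup>2 \<partial>lborel) \<le> 2 * pi * B ^ 4 / (?u * sqrt ?u)"
  proof -
    have uB: "?u \<le> B * exp b" using mom_le[of b 1] b by simp
    have "?u * sqrt ?u \<le> (B * exp b) * (B * exp b)"
      using ru u uB by (intro mult_mono) auto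
    then have "(?u * sqrt ?u) * (exp (- rho b) * (\<integral>t. (norm (transform b t))\<^sup>2 \<partial>lborel))
       \<le> ((B * exp b) * (B * exp b)) * (exp (- rho b) * (2 * pi * (B * exp b)\<^sup>2))"
      by (rule mult_mono) (use transform_sq_integral[of b] b in auto)
    also have "\<dots> = 2 * pi * B ^ 4 * (exp (- rho b) * exp b ^ 4)"
      by (simp add: power2_eq_square numeral_eq_Suc)
    also have "exp b ^ 4 = exp (4 * b)"
      using exp_of_nat_mult[of 4 b] by simp
    also have "2 * pi * B ^ 4 * (exp (- rho b) * exp (4 * b)) \<le> 2 * pi * B ^ 4 * 1"
      using rho B_nonneg by (intro mult_left_mono) auto
    finally show ?thesis
      using ru u by (simp add: field_simps)
  qed
  have "integral\<^sup>L lborel (err b) = ?X"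
    using hbi by (simp add: has_bochner_integral_iff)
  also have "\<dots> \<le> 61440 / (?u * sqrt ?u) + 399360 / (?u * sqrt ?u) + 108 / (?u * sqrt ?u) + 2 * pi * B ^ 4 / (?u * sqrt ?u)"
    by (intro add_mono A Bt C D)
  also have "\<dots> = (460908 + 2 * pi * B ^ 4) / (?u * sqrt ?u)"
    by (simp add: add_divide_distrib)
  also have "\<dots> \<le> (500000 + 2 * pi * B ^ 4) / (?u * sqrt ?u)"
    using ru u by (intro divide_right_mono) auto
  finally show "integral\<^sup>L lborel (err b) \<le> (500000 + 2 * pi * B ^ 4) / (?u * sqrt ?u)" .
qed

lemma edgeworth_integral: 
  assumes v: "0 < mom 2 b"
  shows "has_bochner_integral lborel (edgeworth b) (complex_of_real (sqrt (2 * pi / mom 2 b)))"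
proof -
  let ?g = "\<lambda>t. exp (- (mom 2 b * t\<^sup>2 / 2)) :: real"
  have even: "has_bochner_integral lborel (\<lambda>t. complex_of_real (?g t * t ^ (2 * 0))) (complex_of_real (sqrt (2 * pi / mom 2 b) * (fact (2 * 0) / ((2 * mom 2 b) ^ 0 * fact 0))))"
    by (rule has_bochner_integral_of_real, rule gaussian_moments(1)[OF v])
  have odd: "has_bochner_integral lborel (\<lambda>t. \<i> * complex_of_real (mom 3 b / 6) * complex_of_real (?g t * t ^ (2 * 1 + 1))) (\<i> * complex_of_real (mom 3 b / 6) * complex_of_real 0)"
    by (rule has_bochner_integral_mult_right, rule has_bochner_integral_of_real, rule gaussian_moments(2)[OF v])
  have eq: "edgeworth b t = complex_of_real (?g t * t ^ (2 * 0)) - \<i> * complex_of_real (mom 3 b / 6) * complex_of_real (?g t * t ^ (2 * 1 + 1))" for t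
    by (simp add: edgeworth_def right_diff_distrib power3_eq_cube)
  show ?thesis
    using has_bochner_integral_diff[OF even odd] unfolding eq[symmetric] by simp
qed

text \<open>The summand \<open>500000 + 2 * pi * B ^ 4\<close> is the constant of \<open>err_integral\<close>; the surplus \<open>100\<close> leaves room for
  the cost \<open>64\<close> of dropping the cubic term in \<open>centred_integral_shifted\<close>.\<close>

definition err_const :: real where
  "err_const = 500100 + 2 * pi * B ^ 4"

lemma err_const_ge: "500100 \<le> err_const"
  by (simp add: err_const_def)

text \<open>What the estimates need of the tilting parameter; it holds for all sufficiently large \<open>b\<close>.\<close>

definition good :: "real \<Rightarrow> bool" where
  "good b \<longleftrightarrow> 1 \<le> b \<and> mom 1 b \<le> 4 * mom 2 b \<and> exp (- rho b) * exp (4 * b) \<le> 1"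

lemma eventually_good: "\<forall>\<^sub>F b in at_top. good b"
  using eventually_ge_at_top[of 1] mom_1_le_mom_2 rho_large unfolding good_def by eventually_elim auto

lemma centred_integral:
  assumes b: "good b" and u: "1 \<le> mom 1 b"
  shows "norm ((\<integral>t. centred b t \<partial>lborel) - complex_of_real (sqrt (2 * pi / mom 2 b))) \<le> err_const / (mom 1 b * sqrt (mom 1 b))"
proof -
  have b0: "0 < b" and var: "mom 1 b \<le> 4 * mom 2 b" and rho: "exp (- rho b) * exp (4 * b) \<le> 1"
    using b by (auto simp: good_def)
  have v: "0 < mom 2 b" using var u by simp
  have "(\<integral>t. centred b t \<partial>lborel) - complex_of_real (sqrt (2 * pi / mom 2 b)) = (\<integral>t. centred b t - edgeworth b t \<partial>lborel)"
    unfolding has_bochner_integral_integral_eq[OF edgeworth_integral[OF v], symmetric]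
    by (rule Bochner_Integration.integral_diff[OF centred_integrable integrable.intros[OF edgeworth_integral[OF v]], symmetric])
  then have "norm ((\<integral>t. centred b t \<partial>lborel) - complex_of_real (sqrt (2 * pi / mom 2 b))) \<le> integral\<^sup>L lborel (err b)"
    using norm_integral_le[OF err_integral(1)[OF b0 var u rho] centred_edgeworth_le_err[OF b0 var u]] by (simp only:)
  also have "\<dots> \<le> (500000 + 2 * pi * B ^ 4) / (mom 1 b * sqrt (mom 1 b))"
    by (rule err_integral(2)[OF b0 var u rho])
  also have "\<dots> \<le> err_const / (mom 1 b * sqrt (mom 1 b))"
    using u by (intro divide_right_mono) (auto simp: err_const_def)
  finally show ?thesis .
qed

text \<open>Away from the centre the cubic term no longer cancels, and neither it nor the oscillation is
  worth keeping: \<open>norm (exp (- \<i> * t * y) - 1) \<le> \<bar>t\<bar> * y\<close> and \<open>\<bar>t\<bar> ^ 3 * u\<close> integrate against the Gaussian to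
  \<open>O (y / u)\<close> and \<open>O (1 / u)\<close>.\<close>

lemma centred_integral_shifted:
  assumes b: "good b" and u: "1 \<le> mom 1 b" and y: "0 \<le> y"
  shows "norm ((\<integral>t. centred b t * exp (- (\<i> * complex_of_real (t * y))) \<partial>lborel) - complex_of_real (sqrt (2 * pi / mom 2 b)))
    \<le> err_const * (1 + y) / mom 1 b"
proof -
  let ?u = "mom 1 b" and ?v = "mom 2 b"
  have b0: "0 < b" and var: "?u \<le> 4 * ?v" and rho: "exp (- rho b) * exp (4 * b) \<le> 1"
    using b by (auto simp: good_def)
  have v: "0 < ?v" using var u by simp
  let ?g = "\<lambda>t. exp (- (?v * t\<^sup>2 / 2)) :: real"
  let ?e = "\<lambda>t. exp (- (\<i> * complex_of_real (t * y)))"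
  have g_int: "has_bochner_integral lborel (\<lambda>t. complex_of_real (?g t)) (complex_of_real (sqrt (2 * pi / ?v)))"
    using has_bochner_integral_of_real[OF gaussian_moments(1)[OF v, of 0]] by simp
  have pe_int: "integrable lborel (\<lambda>t. centred b t * ?e t)"
  proof (rule Bochner_Integration.integrable_bound[OF centred_integrable[of b]])
    have [measurable]: "centred b \<in> borel_measurable borel"
      using centred_integrable[of b] by auto
    show "(\<lambda>t. centred b t * ?e t) \<in> borel_measurable lborel" by measurable
    show "AE t in lborel. norm (centred b t * ?e t) \<le> norm (centred b t)"
      by (simp add: norm_mult)
  qed
  let ?d = "\<lambda>t. y * (?g t * \<bar>t\<bar> ^ (2 * 0 + 1)) + ?u * (?g t * \<bar>t\<bar> ^ (2 * 1 + 1))"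
  have d_int: "has_bochner_integral lborel ?d (y * (2 * (2 ^ 0 * fact 0 / ?v ^ (0 + 1))) + ?u * (2 * (2 ^ 1 * fact 1 / ?v ^ (1 + 1))))"
    by (rule has_bochner_integral_add[OF has_bochner_integral_mult_right[OF gaussian_moments(3)[OF v, of 0], where c = y]
          has_bochner_integral_mult_right[OF gaussian_moments(3)[OF v, of 1], where c = ?u]])
  have ed_int: "has_bochner_integral lborel (\<lambda>t. err b t + ?d t) (integral\<^sup>L lborel (err b) + (y * (2 * (2 ^ 0 * fact 0 / ?v ^ (0 + 1))) + ?u * (2 * (2 ^ 1 * fact 1 / ?v ^ (1 + 1)))))"
    by (rule has_bochner_integral_add[OF has_bochner_integral_integrable[OF err_integral(1)[OF b0 var u rho]] d_int])
  have pointwise: "norm (centred b t * ?e t - complex_of_real (?g t)) \<le> err b t + ?d t" for t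
  proof -
    have ne: "norm (?e t) = 1" by simp
    let ?c = "\<i> * complex_of_real (t ^ 3 / 6 * mom 3 b)"
    \<comment> \<open>Errors of three kinds: Edgeworth approximation, oscillation \<open>?e t - 1\<close>, cubic term\<close>
    have split: "centred b t * ?e t - complex_of_real (?g t)
       = (centred b t - edgeworth b t) * ?e t + complex_of_real (?g t) * ((?e t - 1) - ?c * ?e t)"
      unfolding edgeworth_def by (simp only: left_diff_distrib right_diff_distrib mult.assoc mult_1_left mult_1_right) simp
    have e1: "norm (?e t - 1) \<le> y * \<bar>t\<bar>"
      using iexp_approx1[of "- (t * y)" 0] y by (simp add: abs_mult mult.commute)
    have "norm ?c = \<bar>t\<bar> ^ 3 / 6 * mom 3 b"
      using mom_nonneg[of 3 b] by (simp add: norm_mult norm_power)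
    also have "\<dots> \<le> \<bar>t\<bar> ^ 3 * ?u"
      using mom_le_mom_1[of 2 b] mom_nonneg[of 3 b] by (intro mult_mono) auto
    finally have c: "norm (?c * ?e t) \<le> \<bar>t\<bar> ^ 3 * ?u"
      by (simp only: norm_mult ne mult_1_right)
    have "norm (centred b t * ?e t - complex_of_real (?g t))
        \<le> norm ((centred b t - edgeworth b t) * ?e t) + norm (complex_of_real (?g t) * ((?e t - 1) - ?c * ?e t))"
      unfolding split by (rule norm_triangle_ineq)
    also have "\<dots> = norm (centred b t - edgeworth b t) + ?g t * norm ((?e t - 1) - ?c * ?e t)"
      by (simp only: norm_mult ne mult_1_right norm_of_real abs_exp_cancel)
    also have "\<dots> \<le> err b t + ?g t * (y * \<bar>t\<bar> + \<bar>t\<bar> ^ 3 * ?u)"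
      using norm_triangle_ineq4[of "?e t - 1" "?c * ?e t"] e1 c
      by (intro add_mono centred_edgeworth_le_err b0 var u mult_left_mono) (linarith, simp)
    also have "?g t * (y * \<bar>t\<bar> + \<bar>t\<bar> ^ 3 * ?u) = ?d t"
      by (simp add: distrib_left power3_eq_cube)
    finally show ?thesis .
  qed
  have ru: "1 \<le> sqrt ?u" using u by simp
  have "(\<integral>t. centred b t * ?e t \<partial>lborel) - complex_of_real (sqrt (2 * pi / ?v)) = (\<integral>t. centred b t * ?e t - complex_of_real (?g t) \<partial>lborel)"
    unfolding has_bochner_integral_integral_eq[OF g_int, symmetric]
    by (rule Bochner_Integration.integral_diff[OF pe_int integrable.intros[OF g_int], symmetric])
  then have "norm ((\<integral>t. centred b t * ?e t \<partial>lborel) - complex_of_real (sqrt (2 * pi / ?v))) \<le> (\<integral>t. err b t + ?d t \<partial>lborel)"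
    using norm_integral_le[OF integrable.intros[OF ed_int] pointwise] by (simp only:)
  also have "\<dots> = integral\<^sup>L lborel (err b) + (2 * y / ?v + 4 * ?u / ?v\<^sup>2)"
    unfolding has_bochner_integral_integral_eq[OF ed_int] by (simp add: power2_eq_square mult.commute)
  also have "\<dots> \<le> (500000 + 2 * pi * B ^ 4) / ?u + (8 * y / ?u + 64 / ?u)"
  proof (intro add_mono)
    have "integral\<^sup>L lborel (err b) \<le> (500000 + 2 * pi * B ^ 4) / (?u * sqrt ?u)"
      by (rule err_integral(2)[OF b0 var u rho])
    also have "\<dots> \<le> (500000 + 2 * pi * B ^ 4) / ?u"
      using u ru by (intro divide_left_mono) auto
    finally show "integral\<^sup>L lborel (err b) \<le> (500000 + 2 * pi * B ^ 4) / ?u" .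
    have "2 * y / ?v \<le> 2 * y / (?u / 4)"
      using u v var y by (intro divide_left_mono) auto
    then show "2 * y / ?v \<le> 8 * y / ?u" by simp
    have "(?u / 4)\<^sup>2 \<le> ?v\<^sup>2"
      using var u by (intro power_mono) auto
    then have "4 * ?u / ?v\<^sup>2 \<le> 4 * ?u / (?u / 4)\<^sup>2"
      using u v by (intro divide_left_mono) auto
    then show "4 * ?u / ?v\<^sup>2 \<le> 64 / ?u"
      using u by (simp add: power2_eq_square)
  qed
  also have "\<dots> = ((500064 + 2 * pi * B ^ 4) + 8 * y) / ?u"
    by (simp add: add_divide_distrib)
  also have "\<dots> \<le> err_const * (1 + y) / ?u"
  proof (intro divide_right_mono)
    have "8 * y \<le> err_const * y"
      using err_const_ge y by (intro mult_right_mono) auto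
    then show "(500064 + 2 * pi * B ^ 4) + 8 * y \<le> err_const * (1 + y)"
      by (simp add: err_const_def distrib_left)
  qed (use u in simp)
  finally show ?thesis .
qed

end

section \<open>Boundedness and measurability of piecewise smooth functions\<close>

lemma bounded_open_interval:
  fixes g :: "real \<Rightarrow> real"
  assumes "c < d" and cont: "continuous_on {c<..<d} g"
    and l: "(g \<longlongrightarrow> l) (at_right c)" and r: "(g \<longlongrightarrow> r) (at_left d)"
  shows "\<exists>K. \<forall>x\<in>{c<..<d}. \<bar>g x\<bar> \<le> K"
proof -
  let ?h = "\<lambda>x. if x = c then l else if x = d then r else g x"
  have "continuous_on {c..d} ?h"
  proof (rule continuous_on_IccI)
    show "(?h \<longlongrightarrow> ?h c) (at_right c)"
      by (rule Lim_transform_eventually[OF _ eventually_mono[OF eventually_at_right_real[OF \<open>c < d\<close>]]]) (use l in auto)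
    show "(?h \<longlongrightarrow> ?h d) (at_left d)"
      by (rule Lim_transform_eventually[OF _ eventually_mono[OF eventually_at_left_real[OF \<open>c < d\<close>]]]) (use r \<open>c < d\<close> in auto)
    show "?h \<midarrow>x\<rightarrow> ?h x" if "c < x" "x < d" for x
    proof (rule Lim_transform_eventually)
      show "g \<midarrow>x\<rightarrow> ?h x"
        using cont that by (auto simp: continuous_on_eq_continuous_at isCont_def)
      have "\<forall>\<^sub>F y in at x. y \<in> {c<..<d}"
        by (rule eventually_at_in_open') (use that in auto)
      then show "\<forall>\<^sub>F y in at x. g y = ?h y"
        by (rule eventually_mono) auto
    qed
  qed fact
  then have "bounded (?h ` {c..d})"
    by (intro compact_imp_bounded compact_continuous_image) auto
  then obtain K where "\<forall>z\<in>?h ` {c..d}. norm z \<le> K"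
    unfolding bounded_iff by blast
  then have K: "\<bar>?h x\<bar> \<le> K" if "x \<in> {c..d}" for x
    using that by force
  have "\<bar>g x\<bar> \<le> K" if "x \<in> {c<..<d}" for x
    using K[of x] that by auto
  then show ?thesis by blast
qed

text \<open>Induction on the number of pieces: each open piece is bounded because of the one-sided
  limits at its ends, and the partition points only add finitely many values.\<close>

lemma piecewise_C_bounded_measurable:
  assumes pw: "piecewise_C k a b g" and k: "0 < k"
  shows "\<exists>K. \<forall>x\<in>{a..b}. \<bar>g x\<bar> \<le> K" and "(\<lambda>x. indicator {a..b} x * g x) \<in> borel_measurable borel"
proof -
  obtain n :: nat and t where t: "t 0 = a" "t n = b"
    and pieces: "\<And>i. i < n \<Longrightarrow> t i < t (Suc i) \<and>
           (\<forall>j<k. \<forall>x\<in>{t i<..<t (Suc i)}. (deriv ^^ j) g differentiable (at x)) \<and>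
           (\<forall>j\<le>k. (\<exists>l. ((deriv ^^ j) g \<longlongrightarrow> l) (at_right (t i))) \<and>
                  (\<exists>l. ((deriv ^^ j) g \<longlongrightarrow> l) (at_left (t (Suc i)))))"
    using pw unfolding piecewise_C_def by blast
  have "t 0 \<le> t m \<and> (\<exists>K. \<forall>x\<in>{t 0..t m}. \<bar>g x\<bar> \<le> K) \<and> (\<lambda>x. indicator {t 0..t m} x * g x) \<in> borel_measurable borel"
    if "m \<le> n" for m
    using that
  proof (induction m)
    case 0
    have "(\<lambda>x. indicator {t 0..t 0} x * g x) = (\<lambda>x. indicator {t 0} x * g (t 0))"
      by (auto split: split_indicator)
    then show ?case by auto
  next
    case (Suc m)
    let ?c = "t m" and ?d = "t (Suc m)"
    from Suc obtain K where K: "\<forall>x\<in>{t 0..?c}. \<bar>g x\<bar> \<le> K"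
      and meas: "(\<lambda>x. indicator {t 0..?c} x * g x) \<in> borel_measurable borel" and le: "t 0 \<le> ?c"
      by auto
    have P: "?c < ?d" "\<forall>j<k. \<forall>x\<in>{?c<..<?d}. (deriv ^^ j) g differentiable (at x)"
      "\<forall>j\<le>k. (\<exists>l. ((deriv ^^ j) g \<longlongrightarrow> l) (at_right ?c)) \<and> (\<exists>l. ((deriv ^^ j) g \<longlongrightarrow> l) (at_left ?d))"
      using pieces[of m] Suc.prems by auto
    note cd = P(1)
    have diff: "\<forall>x\<in>{?c<..<?d}. g differentiable (at x)"
      using P(2)[rule_format, of 0] k by simp
    have lim: "\<exists>l. (g \<longlongrightarrow> l) (at_right ?c)" "\<exists>l. (g \<longlongrightarrow> l) (at_left ?d)"
      using P(3)[rule_format, of 0] by simp_all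
    have cont: "continuous_on {?c<..<?d} g"
      using diff differentiable_imp_continuous_within by (auto simp: continuous_on_eq_continuous_at)
    obtain K' where K': "\<forall>x\<in>{?c<..<?d}. \<bar>g x\<bar> \<le> K'"
      using bounded_open_interval[OF cd cont] lim by blast
    have bd: "\<bar>g x\<bar> \<le> max (max K K') \<bar>g ?d\<bar>" if x: "x \<in> {t 0..?d}" for x
    proof -
      consider "x \<in> {t 0..?c}" | "x \<in> {?c<..<?d}" | "x = ?d"
        using x by fastforce
      then show ?thesis
        by cases (use K K' in \<open>auto simp: le_max_iff_disj\<close>)
    qed
    have "(\<lambda>x. indicator {t 0..?c} x * g x + indicator {?c<..<?d} x *\<^sub>R g x + indicator {?d} x * g ?d) \<in> borel_measurable borel"
      by (intro borel_measurable_add meas borel_measurable_continuous_on_indicator cont) auto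
    moreover have "indicator {t 0..?c} x * g x + indicator {?c<..<?d} x *\<^sub>R g x + indicator {?d} x * g ?d = indicator {t 0..?d} x * g x" for x
      using cd le by (auto split: split_indicator)
    ultimately have "(\<lambda>x. indicator {t 0..?d} x * g x) \<in> borel_measurable borel"
      by (simp only:)
    moreover have "\<exists>K. \<forall>x\<in>{t 0..?d}. \<bar>g x\<bar> \<le> K"
      using bd by blast
    ultimately show ?case
      using cd le by simp
  qed
  from this[of n] show "\<exists>K. \<forall>x\<in>{a..b}. \<bar>g x\<bar> \<le> K" "(\<lambda>x. indicator {a..b} x * g x) \<in> borel_measurable borel"
    using t by auto
qed

section \<open>Density and tail at the saddle point\<close>

context levy_intensity
begin

text \<open>The growth bound \<open>u = mom 1 (\<beta> u) \<le> B * exp (\<beta> u)\<close> forces \<open>\<beta> u\<close> to infinity; so statements about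
  large \<open>b\<close> transfer to large \<open>u\<close>.\<close>

lemma mom_1_inverse_tendsto:
  assumes "\<And>u. 0 < u \<Longrightarrow> mom 1 (\<beta> u) = u"
  shows "filterlim \<beta> at_top at_top"
  unfolding filterlim_at_top
proof
  fix Z :: real
  have "\<forall>\<^sub>F u in at_top. 0 < u \<and> B * exp \<bar>Z\<bar> < u"
    by (intro eventually_conj eventually_gt_at_top)
  then show "\<forall>\<^sub>F u in at_top. Z \<le> \<beta> u"
  proof eventually_elim
    case (elim u)
    show ?case
    proof (rule ccontr)
      assume "\<not> Z \<le> \<beta> u"
      then have "mom 1 (\<beta> u) \<le> mom 1 \<bar>Z\<bar>" by (intro mom_mono) simp
      also have "\<dots> \<le> B * exp \<bar>Z\<bar>" by (rule mom_le) simp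
      finally show False using assms[of u] elim by simp
    qed
  qed
qed

text \<open>The approximation \<open>saddlepoint\<close> as a function of \<open>b\<close>, with \<open>u = mom 1 b\<close>.\<close>

definition saddle :: "real \<Rightarrow> real" where
  "saddle b = exp (mom 0 b - mom 0 0 - mom 1 b * b) / (sqrt (2 * pi) * sqrt (mom 2 b))"

lemma saddle_pos: "good b \<Longrightarrow> 1 \<le> mom 1 b \<Longrightarrow> 0 < saddle b"
  by (auto simp: saddle_def good_def)

text \<open>The first part converts absolute errors of the Fourier integral into errors relative to the
  saddle point value, at the price \<open>\<sigma> \<le> sqrt u\<close>.\<close>

lemma exp_le_saddle:
  assumes "good b" "1 \<le> mom 1 b"
  shows "exp (mom 0 b - mom 0 0 - mom 1 b * b) / (2 * pi) \<le> saddle b * sqrt (mom 1 b)"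
    and "exp (mom 0 b - mom 0 0 - mom 1 b * b) / (2 * pi) * sqrt (2 * pi / mom 2 b) = saddle b"
proof -
  let ?E = "exp (mom 0 b - mom 0 0 - mom 1 b * b)"
  have v: "0 < mom 2 b" using assms by (auto simp: good_def)
  have vu: "mom 2 b \<le> mom 1 b" using mom_le_mom_1[of 1 b] by (simp add: numeral_2_eq_2)
  have pi1: "1 \<le> sqrt (2 * pi)" using pi_gt3 by simp
  have pi2: "2 * pi = sqrt (2 * pi) * sqrt (2 * pi)" by simp
  have E: "?E = saddle b * (sqrt (2 * pi) * sqrt (mom 2 b))"
    using v by (simp add: saddle_def)
  have "?E / (2 * pi) = saddle b * sqrt (mom 2 b) / sqrt (2 * pi)"
    unfolding E
  proof -
    have "a * (s * v) / p = a * v / s" if "p = s * s" "0 < s" for a s v p :: real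
      using that by simp
    from this[OF pi2] show "saddle b * (sqrt (2 * pi) * sqrt (mom 2 b)) / (2 * pi) = saddle b * sqrt (mom 2 b) / sqrt (2 * pi)"
      by simp
  qed
  also have "\<dots> \<le> saddle b * sqrt (mom 2 b) / 1"
    using pi1 saddle_pos[OF assms] v by (intro divide_left_mono) auto
  also have "\<dots> \<le> saddle b * sqrt (mom 1 b)"
    using vu saddle_pos[OF assms] by simp
  finally show "?E / (2 * pi) \<le> saddle b * sqrt (mom 1 b)" .
  have "?E / (2 * pi) * sqrt (2 * pi / mom 2 b) = saddle b * (sqrt (mom 2 b) / sqrt (2 * pi)) * (sqrt (2 * pi) / sqrt (mom 2 b))"
    unfolding \<open>?E / (2 * pi) = saddle b * sqrt (mom 2 b) / sqrt (2 * pi)\<close> real_sqrt_divide by simp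
  also have "\<dots> = saddle b"
    using v by simp
  finally show "?E / (2 * pi) * sqrt (2 * pi / mom 2 b) = saddle b" .
qed

end

locale levy_law = levy_intensity w \<epsilon> B + prob_space M
  for w :: "real \<Rightarrow> real" and \<epsilon> B :: real and M :: "'a measure" +
  fixes T :: "'a \<Rightarrow> real" and f :: "real \<Rightarrow> real"
  assumes T_meas [measurable]: "T \<in> borel_measurable M"
    and exp_T_integrable: "integrable M (\<lambda>\<omega>. exp (\<theta> * T \<omega>))"
    and exp_T_mean: "(\<integral>\<omega>. exp (\<theta> * T \<omega>) \<partial>M) = exp (mom 0 \<theta> - mom 0 0)"
    and density: "defective_density M T f"
    and density_cont: "continuous_on {1<..} f"
begin

lemma Re_of_real_mult: "Re (complex_of_real r * z) = r * Re z"
  by simp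

text \<open>The line of integration \<open>Re z = b\<close> may be chosen independently of \<open>x\<close>; the tail is computed with one
  line for all \<open>x \<ge> mom 1 b\<close>.\<close>

lemma density_eq:
  assumes x: "1 < x"
  shows "f x = exp (mom 0 b - mom 0 0 - b * x) / (2 * pi) *
     Re (\<integral>t. centred b t * exp (- (\<i> * complex_of_real (t * (x - mom 1 b)))) \<partial>lborel)"
proof -
  let ?J = "\<integral>t. centred b t * exp (- (\<i> * complex_of_real (t * (x - mom 1 b)))) \<partial>lborel"
  have "?J = (\<integral>t. complex_of_real (exp (- mom 0 b)) * (residual b t * exp (- (\<i> * complex_of_real (t * x)))) \<partial>lborel)"
  proof (rule Bochner_Integration.integral_cong[OF refl])
    fix t
    have "exp (- (\<i> * complex_of_real (t * mom 1 b))) * exp (- (\<i> * complex_of_real (t * (x - mom 1 b))))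
       = exp (- (\<i> * complex_of_real (t * x)))"
      unfolding exp_add[symmetric] by (rule arg_cong[where f = exp]) (simp add: algebra_simps)
    then show "centred b t * exp (- (\<i> * complex_of_real (t * (x - mom 1 b))))
      = complex_of_real (exp (- mom 0 b)) * (residual b t * exp (- (\<i> * complex_of_real (t * x))))"
      unfolding centred_def by (simp only: mult.assoc)
  qed
  also have "\<dots> = complex_of_real (exp (- mom 0 b)) * (\<integral>t. residual b t * exp (- (\<i> * complex_of_real (t * x))) \<partial>lborel)"
    by (rule integral_mult_right_zero)
  finally have J: "?J = \<dots>" .
  let ?I = "\<integral>t. residual b t * exp (- (\<i> * complex_of_real (t * x))) \<partial>lborel"
  have inv: "complex_of_real (2 * pi * (exp (b * x) * f x)) = complex_of_real (exp (- mom 0 0)) * ?I"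
    by (rule density_inversion[OF prob_space_axioms T_meas exp_T_integrable exp_T_mean density density_cont x])
  have "2 * pi * (exp (b * x) * f x) = exp (- mom 0 0) * Re ?I"
    using arg_cong[OF inv, of Re] by (simp only: Re_complex_of_real Re_of_real_mult)
  moreover have "Re ?J = exp (- mom 0 b) * Re ?I"
    unfolding J by (simp only: Re_of_real_mult)
  moreover have "exp (mom 0 b - mom 0 0 - b * x) = exp (- mom 0 0) / (exp (b * x) * exp (- mom 0 b))"
    by (simp flip: exp_add exp_diff)
  moreover have "2 * pi * (p * y) = q * r \<Longrightarrow> 0 < p \<Longrightarrow> 0 < s \<Longrightarrow> y = q / (p * s) / (2 * pi) * (s * r)" for p q r s y :: real
    by (simp add: field_simps)
  ultimately show ?thesis
    by (simp only: exp_gt_zero)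
qed

lemma density_saddle:
  assumes b: "good b" and u: "1 < mom 1 b"
  shows "\<bar>f (mom 1 b) - saddle b\<bar> \<le> saddle b * (err_const / mom 1 b)"
proof -
  let ?u = "mom 1 b"
  let ?c = "exp (mom 0 b - mom 0 0 - ?u * b) / (2 * pi)"
  let ?P = "\<integral>t. centred b t \<partial>lborel"
  have u1: "1 \<le> ?u" using u by simp
  have "f ?u = ?c * Re ?P"
    using density_eq[OF u, of b] by (simp add: mult.commute)
  then have "f ?u - saddle b = ?c * (Re ?P - sqrt (2 * pi / mom 2 b))"
    unfolding exp_le_saddle(2)[OF b u1, symmetric] by (simp only: right_diff_distrib)
  then have "\<bar>f ?u - saddle b\<bar> = ?c * \<bar>Re (?P - complex_of_real (sqrt (2 * pi / mom 2 b)))\<bar>"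
    by (simp add: abs_mult)
  also have "\<dots> \<le> (saddle b * sqrt ?u) * (err_const / (?u * sqrt ?u))"
    using centred_integral[OF b u1] abs_Re_le_cmod[of "?P - complex_of_real (sqrt (2 * pi / mom 2 b))"]
      saddle_pos[OF b u1] u
    by (intro mult_mono exp_le_saddle(1)[OF b u1]) auto
  also have "\<dots> = saddle b * (err_const / ?u)"
    using u by simp
  finally show ?thesis .
qed

text \<open>The bound \<open>err_const * (1 + y) / u\<close> for the density at \<open>u + y\<close> is integrated against \<open>exp (- b * y)\<close>,
  which gives at most \<open>2 / b\<close> times \<open>err_const / u\<close> because \<open>b \<ge> 1\<close>; relative to the main term
  of order \<open>1 / (b * sqrt u)\<close> this is \<open>1 / sqrt u\<close>.\<close>

lemma tail_saddle:
  assumes b: "good b" and u: "1 < mom 1 b"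
  shows "\<bar>measure M {\<omega> \<in> space M. mom 1 b \<le> T \<omega>} - 1 / b * saddle b\<bar> \<le> 1 / b * saddle b * (2 * err_const / sqrt (mom 1 b))"
proof -
  let ?u = "mom 1 b"
  have u1: "1 \<le> ?u" using u by simp
  have b1: "1 \<le> b" using b by (simp add: good_def)
  let ?C = "exp (mom 0 b - mom 0 0) / (2 * pi)"
  let ?S = "sqrt (2 * pi / mom 2 b)"
  let ?i = "indicator {?u..} :: real \<Rightarrow> real"
  let ?main = "\<lambda>x. ?C * ?S * (?i x * (exp (- (b * x)) * (x - ?u) ^ 0))"
  let ?bound = "\<lambda>x. ?C * (err_const / ?u) * (?i x * (exp (- (b * x)) * (x - ?u) ^ 0) + ?i x * (exp (- (b * x)) * (x - ?u) ^ 1))"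
  have b0: "0 < b" using b1 by simp
  note e0 = exponential_tail_moment[OF b0, of ?u 0]
  note e1 = exponential_tail_moment[OF b0, of ?u 1]
  note main_int = has_bochner_integral_mult_right[OF e0, where c = "?C * ?S"]
  note bound_int = has_bochner_integral_mult_right[OF has_bochner_integral_add[OF e0 e1], where c = "?C * (err_const / ?u)"]
  have C: "?C * exp (- (b * ?u)) = exp (mom 0 b - mom 0 0 - ?u * b) / (2 * pi)"
    by (simp add: mult.commute flip: exp_add)
  have main_val: "?C * ?S * (exp (- (b * ?u)) * fact 0 / b ^ Suc 0) = 1 / b * saddle b"
    unfolding exp_le_saddle(2)[OF b u1, symmetric] C[symmetric] by (simp add: ac_simps)
  have bound_val: "?C * (err_const / ?u) * (exp (- (b * ?u)) * fact 0 / b ^ Suc 0 + exp (- (b * ?u)) * fact 1 / b ^ Suc 1)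
     \<le> 1 / b * saddle b * (2 * err_const / sqrt ?u)"
  proof -
    have "1 / b * (1 / b) \<le> 1 / b * 1"
      using b1 by (intro mult_left_mono) auto
    then have bb: "1 / b + 1 / b * (1 / b) \<le> 2 / b" by simp
    have "?C * (err_const / ?u) * (exp (- (b * ?u)) * fact 0 / b ^ Suc 0 + exp (- (b * ?u)) * fact 1 / b ^ Suc 1)
       = (?C * exp (- (b * ?u))) * (err_const / ?u) * (1 / b + 1 / b * (1 / b))"
      by (simp add: algebra_simps)
    also have "\<dots> \<le> (saddle b * sqrt ?u) * (err_const / ?u) * (2 / b)"
      unfolding C using err_const_ge saddle_pos[OF b u1] b1 u1
      by (intro mult_mono bb exp_le_saddle(1)[OF b u1]) auto
    also have "\<dots> = 1 / b * saddle b * (2 * err_const * (sqrt ?u / ?u))"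
      by (simp add: ac_simps)
    also have "sqrt ?u / ?u = 1 / sqrt ?u"
      using u1 by (simp add: field_simps)
    finally show ?thesis by simp
  qed
  have pointwise: "\<bar>?i x * f x - ?main x\<bar> \<le> ?bound x" for x
  proof (cases "?u \<le> x")
    case True
    define J where "J = (\<integral>t. centred b t * exp (- (\<i> * complex_of_real (t * (x - ?u)))) \<partial>lborel)"
    have J: "norm (J - complex_of_real ?S) \<le> err_const * (1 + (x - ?u)) / ?u"
      unfolding J_def using centred_integral_shifted[OF b u1, of "x - ?u"] True by simp
    have "1 < x" using True u by simp
    moreover have "exp (mom 0 b - mom 0 0 - b * x) = exp (mom 0 b - mom 0 0) * exp (- (b * x))"
      by (simp flip: exp_add)
    ultimately have "f x = ?C * exp (- (b * x)) * Re J"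
      using density_eq[of x b, folded J_def] by simp
    then have "?i x * f x - ?main x = ?C * exp (- (b * x)) * (Re J - ?S)"
      using True by (simp add: right_diff_distrib mult.assoc mult.commute[of ?S])
    then have "\<bar>?i x * f x - ?main x\<bar> = ?C * exp (- (b * x)) * \<bar>Re (J - complex_of_real ?S)\<bar>"
      by (simp add: abs_mult)
    also have "\<dots> \<le> ?C * exp (- (b * x)) * (err_const * (1 + (x - ?u)) / ?u)"
      using J abs_Re_le_cmod[of "J - complex_of_real ?S"] by (intro mult_left_mono) auto
    also have "\<dots> = ?bound x"
      using True by (simp add: distrib_left ac_simps)
    finally show ?thesis .
  qed simp
  have f_meas: "(\<lambda>x. ?i x * f x) \<in> borel_measurable borel"
  proof -
    have "(\<lambda>x. indicator {0<..} x *\<^sub>R f x) \<in> borel_measurable borel"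
      using density by (simp add: defective_density_def set_borel_measurable_def)
    then have "(\<lambda>x. ?i x * (indicator {0<..} x *\<^sub>R f x)) \<in> borel_measurable borel"
      by measurable
    moreover have "?i x * (indicator {0<..} x *\<^sub>R f x) = ?i x * f x" for x
      using u by (auto split: split_indicator)
    ultimately show ?thesis by (simp only:)
  qed
  have "measure M {\<omega> \<in> space M. ?u \<le> T \<omega>} = (\<integral>\<omega>. ?i (T \<omega>) * 1 \<partial>M)"
  proof -
    have "(\<integral>\<omega>. ?i (T \<omega>) * 1 \<partial>M) = (\<integral>\<omega>. indicator {\<omega> \<in> space M. ?u \<le> T \<omega>} \<omega> \<partial>M)"
      by (intro Bochner_Integration.integral_cong) (auto split: split_indicator)
    then show ?thesis by simp
  qed
  also have "\<dots> = (\<integral>x. ?i x * f x * 1 \<partial>lborel)"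
    by (rule defective_density_integral[OF T_meas density]) (use u in auto)
  finally have P: "measure M {\<omega> \<in> space M. ?u \<le> T \<omega>} = (\<integral>x. ?i x * f x \<partial>lborel)" by simp
  have "\<bar>measure M {\<omega> \<in> space M. ?u \<le> T \<omega>} - 1 / b * saddle b\<bar> \<le> integral\<^sup>L lborel ?bound"
    unfolding P main_val[symmetric] has_bochner_integral_integral_eq[OF main_int, symmetric]
    by (rule integral_diff_le_of_pointwise[OF _ integrable.intros[OF main_int] integrable.intros[OF bound_int] pointwise])
       (use f_meas in simp)
  also have "\<dots> \<le> 1 / b * saddle b * (2 * err_const / sqrt ?u)"
    unfolding has_bochner_integral_integral_eq[OF bound_int] by (rule bound_val)
  finally show ?thesis .
qed

end

section \<open>Relative errors\<close>

lemma relative_error_bigo: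
  fixes F S h :: "real \<Rightarrow> real"
  assumes "\<forall>\<^sub>F u in at_top. 0 < S u \<and> \<bar>F u - S u\<bar> \<le> S u * (K * h u)" and "\<forall>\<^sub>F u in at_top. 0 \<le> h u"
  shows "\<exists>r. r \<in> O[at_top](h) \<and> (\<forall>\<^sub>F u in at_top. F u = S u * (1 + r u))"
proof (intro exI conjI)
  let ?r = "\<lambda>u. F u / S u - 1"
  show "?r \<in> O[at_top](h)"
  proof (rule bigoI)
    show "\<forall>\<^sub>F u in at_top. norm (?r u) \<le> K * norm (h u)"
      using assms
    proof eventually_elim
      case (elim u)
      then have "?r u = (F u - S u) / S u"
        by (simp add: diff_divide_distrib)
      then have "\<bar>?r u\<bar> = \<bar>F u - S u\<bar> / S u"
        using elim by (simp only: abs_divide abs_of_pos)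
      also have "\<dots> \<le> K * h u"
        using elim by (simp add: pos_divide_le_eq mult.commute)
      finally show ?case using elim by simp
    qed
  qed
  show "\<forall>\<^sub>F u in at_top. F u = S u * (1 + ?r u)"
    using assms(1) by eventually_elim simp
qed

lemma relative_error_quotient:
  fixes P f S :: "real \<Rightarrow> real"
  assumes f: "\<forall>\<^sub>F u in at_top. f u = S u * (1 + r u)" and r: "r \<in> O[at_top](\<lambda>u. 1 / u)"
    and P: "\<forall>\<^sub>F u in at_top. P u = c u * S u * (1 + q u)" and q: "q \<in> O[at_top](\<lambda>u. 1 / sqrt u)"
  shows "\<exists>s. s \<in> O[at_top](\<lambda>u. 1 / sqrt u) \<and> (\<forall>\<^sub>F u in at_top. P u = f u * c u * (1 + s u))"
proof (intro exI conjI)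
  let ?s = "\<lambda>u. (q u - r u) / (1 + r u)"
  have "(\<lambda>u :: real. 1 / u) \<in> O[at_top](\<lambda>u. 1 / sqrt u)"
    by real_asymp
  then have r': "r \<in> O[at_top](\<lambda>u. 1 / sqrt u)"
    using r by (rule landau_o.big_trans[rotated])
  have "(\<lambda>u :: real. 1 / u) \<in> o[at_top](\<lambda>_. 1 :: real)"
    by real_asymp
  from smalloD_tendsto[OF landau_o.big_small_trans[OF r this]] have "(r \<longlongrightarrow> 0) at_top"
    by simp
  then have r_small: "\<forall>\<^sub>F u in at_top. \<bar>r u\<bar> < 1 / 2"
    using order_tendstoD(2)[of "\<lambda>u. \<bar>r u\<bar>" 0 at_top "1 / 2"] tendsto_rabs_zero by auto
  have "(\<lambda>u. 1 / (1 + r u)) \<in> O[at_top](\<lambda>_. 1)"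
  proof (rule bigoI)
    show "\<forall>\<^sub>F u in at_top. norm (1 / (1 + r u)) \<le> 2 * norm (1 :: real)"
      using r_small
    proof eventually_elim
      case (elim u)
      then have "1 / 2 \<le> 1 + r u" by linarith
      then show ?case by (simp add: divide_le_eq)
    qed
  qed
  from landau_o.big.mult[OF sum_in_bigo(2)[OF q r'] this]
  show "?s \<in> O[at_top](\<lambda>u. 1 / sqrt u)" by simp
  show "\<forall>\<^sub>F u in at_top. P u = f u * c u * (1 + ?s u)"
    using f P r_small
  proof eventually_elim
    case (elim u)
    then have "1 + r u \<noteq> 0" by linarith
    then have "1 + q u = (1 + r u) * (1 + ?s u)" by (simp add: distrib_left)
    then have "P u = c u * S u * ((1 + r u) * (1 + ?s u))" using elim by (simp only:)
    also have "\<dots> = S u * (1 + r u) * c u * (1 + ?s u)" by (simp only: ac_simps)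
    also have "S u * (1 + r u) = f u" using elim by simp
    finally show ?case .
  qed
qed

theorem theorem1:
  fixes g :: "real \<Rightarrow> real" and \<epsilon> :: real
    and M :: "'a measure" and T :: "'a \<Rightarrow> real"
    and f :: "real \<Rightarrow> real" and \<beta> :: "real \<Rightarrow> real"
  assumes g_nonneg: "\<And>x. x \<in> {0..1} \<Longrightarrow> 0 \<le> g x"
    and g_pw: "piecewise_C 2 0 1 g"
    and eps_pos: "0 < \<epsilon>"
    and g_lower: "\<And>x. x \<in> {0..1} \<Longrightarrow> x \<in> {1 - \<epsilon>..1} \<Longrightarrow> \<epsilon> \<le> g x"
    and M: "prob_space M"
    and T: "has_levy_density M T g"
    and f: "defective_density M T f"
    and f_cont: "continuous_on {1<..} f"
    and beta: "\<And>u. 0 < u \<Longrightarrow> deriv (levy_cgf g) (\<beta> u) = u"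
  shows "(\<exists>r. r \<in> O[at_top](\<lambda>u. 1 / u) \<and>
            (\<forall>\<^sub>F u in at_top. f u = saddlepoint g (\<beta> u) u * (1 + r u))) \<and>
         (\<exists>r. r \<in> O[at_top](\<lambda>u. 1 / sqrt u) \<and>
            (\<forall>\<^sub>F u in at_top. measure M {\<omega> \<in> space M. u \<le> T \<omega>} =
               1 / \<beta> u * saddlepoint g (\<beta> u) u * (1 + r u))) \<and>
         (\<exists>r. r \<in> O[at_top](\<lambda>u. 1 / sqrt u) \<and>
            (\<forall>\<^sub>F u in at_top. measure M {\<omega> \<in> space M. u \<le> T \<omega>} =
               f u / \<beta> u * (1 + r u)))"
proof -
  interpret M: prob_space M by (rule M)
  let ?w = "\<lambda>x. indicator {0..1} x * g x"
  obtain B where B: "\<forall>x\<in>{0..1}. \<bar>g x\<bar> \<le> B"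
    using piecewise_C_bounded_measurable(1)[OF g_pw] by auto
  interpret levy_intensity ?w "min \<epsilon> (1 / 2)" B
  proof
    show "?w \<in> borel_measurable borel"
      by (rule piecewise_C_bounded_measurable(2)[OF g_pw]) simp
    show "0 \<le> ?w x" for x using g_nonneg by (auto split: split_indicator)
    show "?w x \<le> B" for x using bspec[OF B, of x] bspec[OF B, of 0] by (auto split: split_indicator)
    show "?w x = 0" if "x \<notin> {0..1}" for x using that by simp
    show "min \<epsilon> (1 / 2) \<le> ?w x" if "x \<in> {1 - min \<epsilon> (1 / 2)..1}" for x
      using that g_lower[of x] by (auto simp: min_def split: if_splits)
  qed (use eps_pos in auto)
  have cgf: "levy_cgf g = (\<lambda>\<theta>. mom 0 \<theta> - mom 0 0)"
  proof
    fix \<theta>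
    have "mom 0 \<theta> - mom 0 0 = (\<integral>x. ?w x * x ^ 0 * exp (\<theta> * x) - ?w x * x ^ 0 * exp (0 * x) \<partial>lborel)"
      unfolding mom_def by (rule Bochner_Integration.integral_diff[OF mom_integrable mom_integrable, symmetric])
    also have "\<dots> = levy_cgf g \<theta>"
      unfolding levy_cgf_def set_lebesgue_integral_def
      by (intro Bochner_Integration.integral_cong) (auto simp: algebra_simps)
    finally show "levy_cgf g \<theta> = mom 0 \<theta> - mom 0 0" by simp
  qed
  have deriv1: "deriv (levy_cgf g) = mom 1"
  proof
    fix \<theta>
    show "deriv (levy_cgf g) \<theta> = mom 1 \<theta>"
      unfolding cgf using mom_has_real_derivative[of 0 \<theta>]
      by (intro DERIV_imp_deriv) (auto intro!: derivative_eq_intros)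
  qed
  have deriv2: "deriv (mom 1) = mom 2"
    using mom_has_real_derivative[of 1] by (intro ext DERIV_imp_deriv) (simp add: numeral_2_eq_2)
  have beta': "mom 1 (\<beta> u) = u" if "0 < u" for u
    using beta[OF that] by (simp add: deriv1)
  have saddle: "saddlepoint g (\<beta> u) u = saddle (\<beta> u)" if "0 < u" for u
    unfolding saddlepoint_def deriv1 deriv2 unfolding saddle_def cgf beta'[OF that] ..
  from T have T_meas: "T \<in> borel_measurable M" and T_int: "\<And>\<theta>. integrable M (\<lambda>\<omega>. exp (\<theta> * T \<omega>))"
    and T_ln: "\<And>\<theta>. ln (\<integral>\<omega>. exp (\<theta> * T \<omega>) \<partial>M) = levy_cgf g \<theta>"
    unfolding has_levy_density_def by auto
  have T_pos: "0 < (\<integral>\<omega>. exp (\<theta> * T \<omega>) \<partial>M)" for \<theta>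
  proof -
    have "0 \<le> (\<integral>\<omega>. exp (\<theta> * T \<omega>) \<partial>M)" by simp
    moreover have "(\<integral>\<omega>. exp (\<theta> * T \<omega>) \<partial>M) \<noteq> 0"
    proof
      assume "(\<integral>\<omega>. exp (\<theta> * T \<omega>) \<partial>M) = 0"
      then have "AE \<omega> in M. exp (\<theta> * T \<omega>) = 0"
        by (subst (asm) integral_nonneg_eq_0_iff_AE) (use T_int in auto)
      then show False by simp
    qed
    ultimately show ?thesis by linarith
  qed
  interpret levy_law ?w "min \<epsilon> (1 / 2)" B M T f
  proof
    show "T \<in> borel_measurable M" by (rule T_meas)
    show "integrable M (\<lambda>\<omega>. exp (\<theta> * T \<omega>))" for \<theta> by (rule T_int)
    show "(\<integral>\<omega>. exp (\<theta> * T \<omega>) \<partial>M) = exp (mom 0 \<theta> - mom 0 0)" for \<theta>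
      using exp_ln[OF T_pos[of \<theta>]] unfolding T_ln cgf by simp
  qed (use f f_cont in auto)
  have "filterlim \<beta> at_top at_top"
    by (rule mom_1_inverse_tendsto) (rule beta')
  from eventually_compose_filterlim[OF eventually_good this]
  have "\<forall>\<^sub>F u in at_top. good (\<beta> u)" .
  then have ev: "\<forall>\<^sub>F u in at_top. 1 < u \<and> good (\<beta> u)"
    by (intro eventually_conj eventually_gt_at_top)
  have pos: "\<forall>\<^sub>F u :: real in at_top. 0 \<le> 1 / u" "\<forall>\<^sub>F u :: real in at_top. 0 \<le> 1 / sqrt u"
    using eventually_gt_at_top[of "0 :: real"] by (eventually_elim, simp)+
  have "\<forall>\<^sub>F u in at_top. 0 < saddlepoint g (\<beta> u) u \<and>
      \<bar>f u - saddlepoint g (\<beta> u) u\<bar> \<le> saddlepoint g (\<beta> u) u * (err_const * (1 / u))"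
    using ev
  proof eventually_elim
    case (elim u)
    then show ?case
      using density_saddle[of "\<beta> u"] saddle_pos[of "\<beta> u"] saddle[of u] beta'[of u] by simp
  qed
  from relative_error_bigo[OF this pos(1)] obtain r where
    r: "r \<in> O[at_top](\<lambda>u. 1 / u)" and fr: "\<forall>\<^sub>F u in at_top. f u = saddlepoint g (\<beta> u) u * (1 + r u)" by blast
  have "\<forall>\<^sub>F u in at_top. 0 < 1 / \<beta> u * saddlepoint g (\<beta> u) u \<and>
      \<bar>measure M {\<omega> \<in> space M. u \<le> T \<omega>} - 1 / \<beta> u * saddlepoint g (\<beta> u) u\<bar>
        \<le> 1 / \<beta> u * saddlepoint g (\<beta> u) u * (2 * err_const * (1 / sqrt u))"
    using ev
  proof eventually_elim
    case (elim u)
    then have "0 < \<beta> u" by (simp add: good_def)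
    with elim show ?case
      using tail_saddle[of "\<beta> u"] saddle_pos[of "\<beta> u"] saddle[of u] beta'[of u] by simp
  qed
  from relative_error_bigo[OF this pos(2)] obtain q where
    q: "q \<in> O[at_top](\<lambda>u. 1 / sqrt u)" and Pq: "\<forall>\<^sub>F u in at_top. measure M {\<omega> \<in> space M. u \<le> T \<omega>}
      = 1 / \<beta> u * saddlepoint g (\<beta> u) u * (1 + q u)" by blast
  from relative_error_quotient[OF fr r Pq q] obtain s where
    s: "s \<in> O[at_top](\<lambda>u. 1 / sqrt u)" and
    Ps: "\<forall>\<^sub>F u in at_top. measure M {\<omega> \<in> space M. u \<le> T \<omega>} = f u * (1 / \<beta> u) * (1 + s u)" by blast
  show ?thesis
  proof (intro conjI)
    show "\<exists>r. r \<in> O[at_top](\<lambda>u. 1 / u) \<and> (\<forall>\<^sub>F u in at_top. f u = saddlepoint g (\<beta> u) u * (1 + r u))"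
      using r fr by blast
    show "\<exists>r. r \<in> O[at_top](\<lambda>u. 1 / sqrt u) \<and> (\<forall>\<^sub>F u in at_top. measure M {\<omega> \<in> space M. u \<le> T \<omega>} =
        1 / \<beta> u * saddlepoint g (\<beta> u) u * (1 + r u))"
      using q Pq by blast
    show "\<exists>r. r \<in> O[at_top](\<lambda>u. 1 / sqrt u) \<and> (\<forall>\<^sub>F u in at_top. measure M {\<omega> \<in> space M. u \<le> T \<omega>} =
        f u / \<beta> u * (1 + r u))"
      using s Ps by auto
  qed
qed

end
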